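(* Let $\mathcal{A}_{s,M}$ in the input to the Phase Encoding algorithm (described in the context) be a noise-robust SFT algorithm which, for a function $a\in\mathcal{W}(\mathbb{T})\cap C(\mathbb{T})$ corrupted by some arbitrary noise $\mu:\mathbb{T}\to\mathbb{C}$, constructs an $s$-sparse Fourier approximation $\mathcal{A}_{s,M}(a+\mu)=:\mathbf v\in\mathbb{C}^M$ which 1. reconstructs every frequency (up to $s$ many) $\omega\in\mathcal{B}_M$ of $\mathbf F_M\mathbf a\in\mathbb{C}^M$ with corresponding Fourier coefficient meeting the tolerance $|(\mathbf F_M\mathbf a)_\omega|>\tau$; 2. satisfies the $\ell^\infty$ error estimate for recovered coefficients $$\|(\mathbf F_M\mathbf a-\mathbf v)|_{\operatorname{supp}(\mathbf v)}\|_\infty\le\eta_\infty<\tau;$$ 3. satisfies the $\ell^2$ error estimate $\|\mathbf F_M\mathbf a-\mathbf v\|_2\le\eta_2$; 4. and requires $\mathcal{O}(P(s,M))$ total evaluations of $a$, operating with computational complexity $\mathcal{O}(R(s,M))$. Additionally, assume that the parameters $\tau$ and $\eta_\infty$ hold uniformly for each SFT performed in the Phase Encoding algorithm. Let $f$, $\mathcal{I}$, and $\Lambda(\mathbf z,M)$ be as specified in the input to the Phase Encoding algorithm. Collecting the $\tau$-significant frequencies of $f$ into the set $\mathcal{S}_\tau:=\{\mathbf k\in\mathcal{I}\mid|c_{\mathbf k}(f)|>\tau\}$, assume that $|\operatorname{supp}(c(f))\cap\mathcal{S}_\tau|\le s$, and set $$\beta=\max\left(\tau,\ \eta_\infty\left(1+\frac{2}{\sin\left(\frac\pi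 N\right)}\right)\right).$$ Then the Phase Encoding algorithm (ignoring its optional check) will produce an $s$-sparse approximation $\mathbf b$ of the Fourier coefficients of $f$ satisfying the error estimate $$\|\mathbf b-c(f)\|_{\ell^2(\mathbb{Z}^d)}\le\eta_2+(\beta+\eta_\infty)\sqrt{\max(s-|\mathcal{S}_\beta|,0)}+\|c(f)|_{\mathcal{I}}-c(f)|_{\mathcal{S}_\beta}\|_{\ell^2(\mathbb{Z}^d)}+\|c(f)-c(f)|_{\mathcal{I}}\|_{\ell^2(\mathbb{Z}^d)},$$ requiring $\mathcal{O}(d\cdot P(s,M))$ total evaluations of $f$, in $\mathcal{O}(d\cdot(R(s,M)+s))$ total operations.
   Context: Notation. $\mathbb{T}=[0,1]$ with endpoints identified; $[n]=\{0,\dots,n-1\}$; $\mathcal{B}_N:=(-\lceil N/2\rceil,\lfloor N/2\rfloor]\cap\mathbb{Z}$. For $f:\mathbb{T}^d\to\mathbb{C}$, $c_{\mathbf k}(f)=\int_{\mathbb{T}^d}f(\mathbf x)e^{-2\pi i\mathbf k\cdot\mathbf x}\,d\mathbf x$ and $c(f)=(c_{\mathbf k}(f))_{\mathbf k\in\mathbb{Z}^d}$; $\mathcal{W}(\mathbb{T}^d)=\{f\in L^1(\mathbb{T}^d):\sum_{\mathbf k}|c_{\mathbf k}(f)|<\infty\}$ and $C(\mathbb{T}^d)$ is the space of continuous functions. $c(f)|_{\mathcal{J}}$ is the restriction to $\mathcal{J}\subset\mathbb{Z}^d$; finite vectors and restrictions are extended by zero when compared with sequences on larger index sets. $\mathcal{S}_\beta$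 is defined as $\mathcal{S}_\tau$ with $\beta$ in place of $\tau$. "$s$-sparse" means at most $s$ nonzero entries. The $d$ coordinates are indexed by $\ell\in[d]$. For univariate $a$, $\mathbf a=(a(j/M))_{j\in[M]}$ and $(\mathbf F_M\mathbf a)_\omega=\frac1M\sum_{j\in[M]}a(j/M)e^{-2\pi i\omega j/M}$; indices of vectors in $\mathbb{C}^M$ are taken implicitly modulo $M$. The shift operator $S_{\ell,\alpha}$ maps $f$ to the function of $\mathbf x$ obtained by evaluating $f$ with coordinate $x_\ell$ replaced by $(x_\ell+\alpha)\bmod1$ and all other coordinates unchanged. An SFT (sparse Fourier transform) algorithm $\mathcal{A}_{s,M}$ takes a univariate function, accessed through point evaluations, and returns an $s$-sparse vector $\mathbf v\in\mathbb{C}^M$; it "reconstructs" $\omega$ if $\omega\in\operatorname{supp}(\mathbf v)$. Reconstructing lattice. For a generating vector $\mathbf z\in\mathbb{Z}^d$ (without loss of generality $\mathbf z\in[M]^d$), the rank-1 lattice is $\Lambda(\mathbf z,M)=\{\frac jM\mathbf z\bmod1\mid j\in[M]\}$; it is reconstructing for $\mathcal{I}$ if $\mathbf k\mapsto\mathbf k\cdot\mathbf z\bmod M$ is injective on $\mathcal{I}$. Phase Encoding algorithm. Input: a multivariate periodic function $f\in\mathcal{W}(\mathbb{T}^d)\cap C(\mathbb{T}^d)$ (from which potentially noisy samples can be obtained), a finite multivariate frequency set $\mathcal{I}\subset\mathcal{B}_N^d$, a reconstructing rank-1 lattice $\Lambda(\mathbf z,M)$ for $\mathcal{I}$, and an SFT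 algorithm $\mathcal{A}_{s,M}$. (i) Apply $\mathcal{A}_{s,M}$ to $a(t)=f(t\mathbf z)$ to produce $\mathbf v=\mathcal{A}_{s,M}a$, a sparse approximation of $\mathbf F_M\mathbf a$. (ii) For every $\ell\in[d]$ apply $\mathcal{A}_{s,M}$ to $a^\ell(t)=S_{\ell,1/N}f(t\mathbf z)$ to produce $\mathbf v^\ell=\mathcal{A}_{s,M}a^\ell$, a sparse approximation of $\mathbf F_M\mathbf a^\ell$. (iii) Set $\mathbf b\leftarrow\mathbf 0$. For every $\omega\in\operatorname{supp}(\mathbf v)\subset\mathcal{B}_M$: for every $\ell\in[d]$ set $(k_\omega)_\ell\leftarrow\operatorname{round}\big(N\arg(v^\ell_\omega/v_\omega)/2\pi\big)$; then, if $\mathbf k_\omega\cdot\mathbf z\equiv\omega\pmod M$ (and, as an optional check, $\mathbf k_\omega\in\mathcal{I}$), set $b_{\mathbf k_\omega}\leftarrow b_{\mathbf k_\omega}+v_\omega$. Output: the sparse coefficient vector $\mathbf b=(b_{\mathbf k})_{\mathbf k\in\mathcal{B}_N^d}$.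
   Formalization: The SFT guarantees (τ, η∞, η2) refer to a(t)=f_I(tz) and its shifts, where f_I is the part of f with frequencies in I; the rest of f counts as noise. Rounded components are reduced modulo N into B_N, and N≥2. *)

theory Defs
  imports
    "HOL-Analysis.Analysis"
    "HOL-Number_Theory.Cong"
    "HOL-Library.Poly_Mapping"
    "HOL-Library.Monad_Syntax"
begin

section \<open>Functions on the torus and their Fourier coefficients\<close>

text \<open>
  The dimension is a natural number because the complexity bounds are uniform in it.  Points of
  \<open>R^d\<close> and frequencies in \<open>Z^d\<close> are extensional functions on \<open>{..<d}\<close>; functions on
  \<open>T^d\<close> are functions on \<open>R^d\<close> with period 1 in each coordinate; univariate functions are
  the case \<open>d = 1\<close> up to the identification of \<open>T\<close> with \<open>T^1\<close>.
\<close>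

definition torus_fun :: "nat \<Rightarrow> ((nat \<Rightarrow> real) \<Rightarrow> complex) \<Rightarrow> bool" where
  "torus_fun d f \<longleftrightarrow>
    (\<forall>x \<in> {..<d} \<rightarrow>\<^sub>E UNIV. \<forall>l<d. f (x(l := x l + 1)) = f x)"

definition torus_measure :: "nat \<Rightarrow> (nat \<Rightarrow> real) measure" where
  "torus_measure d = PiM {..<d} (\<lambda>_. restrict_space lborel {0..1})"

definition freqs :: "nat \<Rightarrow> (nat \<Rightarrow> int) set" where
  "freqs d = {..<d} \<rightarrow>\<^sub>E UNIV"

definition character :: "nat \<Rightarrow> (nat \<Rightarrow> int) \<Rightarrow> (nat \<Rightarrow> real) \<Rightarrow> complex" where
  "character d k x = exp (2 * of_real pi * \<i> * of_real (\<Sum>l<d. of_int (k l) * x l))"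

definition fourier_coeff ::
    "nat \<Rightarrow> ((nat \<Rightarrow> real) \<Rightarrow> complex) \<Rightarrow> (nat \<Rightarrow> int) \<Rightarrow> complex" where
  "fourier_coeff d f k =
    integral\<^sup>L (torus_measure d) (\<lambda>x. f x * character d (\<lambda>l. - k l) x)"

text \<open>The space \<open>W(T^d) \<inter> C(T^d)\<close>.\<close>

definition wiener_continuous :: "nat \<Rightarrow> ((nat \<Rightarrow> real) \<Rightarrow> complex) \<Rightarrow> bool" where
  "wiener_continuous d f \<longleftrightarrow>
    torus_fun d f \<and>
    integrable (torus_measure d) f \<and>
    (\<lambda>k. norm (fourier_coeff d f k)) summable_on freqs d \<and>
    continuous_on ({..<d} \<rightarrow>\<^sub>E UNIV) f"

definition univariate :: "(real \<Rightarrow> complex) \<Rightarrow> (nat \<Rightarrow> real) \<Rightarrow> complex" where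
  "univariate a = (\<lambda>x. a (x 0))"

definition fourier_part ::
    "nat \<Rightarrow> (nat \<Rightarrow> int) set \<Rightarrow> ((nat \<Rightarrow> real) \<Rightarrow> complex) \<Rightarrow> (nat \<Rightarrow> real) \<Rightarrow> complex" where
  "fourier_part d I f x = (\<Sum>k\<in>I. fourier_coeff d f k * character d k x)"

definition restrict_seq :: "'k set \<Rightarrow> ('k \<Rightarrow> complex) \<Rightarrow> 'k \<Rightarrow> complex" where
  "restrict_seq J c k = (if k \<in> J then c k else 0)"

definition l2_seq_norm :: "'k set \<Rightarrow> ('k \<Rightarrow> complex) \<Rightarrow> real" where
  "l2_seq_norm J c = sqrt (\<Sum>\<^sub>\<infinity>k\<in>J. (norm (c k))\<^sup>2)"

definition linf_norm :: "'k set \<Rightarrow> ('k \<Rightarrow> complex) \<Rightarrow> real" where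
  "linf_norm J c = Max (insert 0 ((\<lambda>k. norm (c k)) ` J))"

definition freq_band :: "nat \<Rightarrow> int set" where
  "freq_band N = {- \<lceil>real N / 2\<rceil> <.. \<lfloor>real N / 2\<rfloor>}"

definition dft :: "nat \<Rightarrow> (real \<Rightarrow> complex) \<Rightarrow> int \<Rightarrow> complex" where
  "dft M a \<omega> = (1 / of_nat M) *
    (\<Sum>j<M. a (real j / real M) * exp (- 2 * of_real pi * \<i> * of_int \<omega> * of_nat j / of_nat M))"

definition large_coeffs ::
    "nat \<Rightarrow> (nat \<Rightarrow> int) set \<Rightarrow> ((nat \<Rightarrow> real) \<Rightarrow> complex) \<Rightarrow> real \<Rightarrow> (nat \<Rightarrow> int) set" where
  "large_coeffs d I f \<tau> = {k \<in> I. norm (fourier_coeff d f k) > \<tau>}"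


section \<open>Rank-1 lattices and shifts\<close>

definition freq_dot :: "nat \<Rightarrow> (nat \<Rightarrow> int) \<Rightarrow> (nat \<Rightarrow> int) \<Rightarrow> int" where
  "freq_dot d k z = (\<Sum>l<d. k l * z l)"

definition reconstructing :: "nat \<Rightarrow> (nat \<Rightarrow> int) set \<Rightarrow> (nat \<Rightarrow> int) \<Rightarrow> nat \<Rightarrow> bool" where
  "reconstructing d I z M \<longleftrightarrow> inj_on (\<lambda>k. freq_dot d k z mod int M) I"

text \<open>The point \<open>t z mod 1\<close>; the lattice itself consists of the points with \<open>t = j / M\<close>.\<close>

definition lattice_line :: "nat \<Rightarrow> (nat \<Rightarrow> int) \<Rightarrow> real \<Rightarrow> nat \<Rightarrow> real" where
  "lattice_line d z t = (\<lambda>l\<in>{..<d}. frac (t * of_int (z l)))"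

definition shift_point :: "nat \<Rightarrow> real \<Rightarrow> (nat \<Rightarrow> real) \<Rightarrow> nat \<Rightarrow> real" where
  "shift_point l \<alpha> x = x(l := frac (x l + \<alpha>))"

definition shift_op ::
    "nat \<Rightarrow> real \<Rightarrow> ((nat \<Rightarrow> real) \<Rightarrow> complex) \<Rightarrow> (nat \<Rightarrow> real) \<Rightarrow> complex" where
  "shift_op l \<alpha> f = (\<lambda>x. f (shift_point l \<alpha> x))"


section \<open>Algorithms with point evaluations\<close>

text \<open>
  A program of type \<open>('q, 'r) prog\<close> adaptively evaluates an unknown complex-valued function at
  points of type \<open>'q\<close> and returns a result of type \<open>'r\<close>.  Each evaluation and each \<open>Tick\<close>
  is one operation.  Computation inside a continuation is not charged by itself, so concrete
  algorithms charge their elementary operations explicitly with \<open>step\<close>.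
\<close>

datatype ('q, 'r) prog =
    Return 'r
  | Query 'q "complex \<Rightarrow> ('q, 'r) prog"
  | Tick "('q, 'r) prog"

primrec run :: "('q, 'r) prog \<Rightarrow> ('q \<Rightarrow> complex) \<Rightarrow> 'r" where
  "run (Return r) g = r"
| "run (Query q h) g = run (h (g q)) g"
| "run (Tick p) g = run p g"

primrec evals :: "('q, 'r) prog \<Rightarrow> ('q \<Rightarrow> complex) \<Rightarrow> nat" where
  "evals (Return r) g = 0"
| "evals (Query q h) g = Suc (evals (h (g q)) g)"
| "evals (Tick p) g = evals p g"

primrec operations :: "('q, 'r) prog \<Rightarrow> ('q \<Rightarrow> complex) \<Rightarrow> nat" where
  "operations (Return r) g = 0"
| "operations (Query q h) g = Suc (operations (h (g q)) g)"
| "operations (Tick p) g = Suc (operations p g)"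

primrec bind_prog :: "('q, 'a) prog \<Rightarrow> ('a \<Rightarrow> ('q, 'b) prog) \<Rightarrow> ('q, 'b) prog" where
  "bind_prog (Return x) k = k x"
| "bind_prog (Query q h) k = Query q (\<lambda>y. bind_prog (h y) k)"
| "bind_prog (Tick p) k = Tick (bind_prog p k)"

adhoc_overloading Monad_Syntax.bind \<rightleftharpoons> bind_prog

text \<open>
  Run a program on \<open>g \<circ> \<phi>\<close> when only \<open>g\<close> can be evaluated.  Locating the point \<open>\<phi> t\<close> is
  part of the evaluation there and is not charged separately.
\<close>

definition sample_via :: "('p \<Rightarrow> 'q) \<Rightarrow> ('p, 'r) prog \<Rightarrow> ('q, 'r) prog" where
  "sample_via \<phi> p = map_prog \<phi> id p"

definition step :: "'r \<Rightarrow> ('q, 'r) prog" where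
  "step r = Tick (Return r)"

text \<open>A loop with loop state; each iteration costs one operation in addition to its body.\<close>

primrec for_each :: "'i list \<Rightarrow> ('i \<Rightarrow> 's \<Rightarrow> ('q, 's) prog) \<Rightarrow> 's \<Rightarrow> ('q, 's) prog" where
  "for_each [] body st = Return st"
| "for_each (i # is) body st = Tick (do { st' \<leftarrow> body i st; for_each is body st' })"


section \<open>Noise-robust sparse Fourier transforms\<close>

text \<open>Sparse vectors are finitely supported; vectors in \<open>C^M\<close> are indexed by \<open>freq_band M\<close>.\<close>

type_synonym sft = "(real, int \<Rightarrow>\<^sub>0 complex) prog"
type_synonym tolerance = "nat \<Rightarrow> nat \<Rightarrow> (real \<Rightarrow> complex) \<Rightarrow> (real \<Rightarrow> complex) \<Rightarrow> real"

text \<open>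
  The accuracy parameters \<open>T\<close>, \<open>Einf\<close>, \<open>E2\<close> may depend on the function and on the
  noise: since the algorithm only sees \<open>a + \<mu>\<close> with \<open>\<mu>\<close> arbitrary, no algorithm meets the
  guarantees with parameters independent of \<open>\<mu>\<close>.  An \<open>s\<close>-sparse output can contain all
  significant frequencies only if there are at most \<open>s\<close> of them; the first guarantee is
  required in that case only.  The constant in the complexity bounds is independent of \<open>s\<close>,
  \<open>M\<close> and the input.
\<close>

definition noise_robust_sft ::
    "(nat \<Rightarrow> nat \<Rightarrow> sft) \<Rightarrow> tolerance \<Rightarrow> tolerance \<Rightarrow> tolerance \<Rightarrow>
     (nat \<Rightarrow> nat \<Rightarrow> real) \<Rightarrow> (nat \<Rightarrow> nat \<Rightarrow> real) \<Rightarrow> bool" where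
  "noise_robust_sft \<A> T Einf E2 P R \<longleftrightarrow>
    (\<forall>s M. 0 \<le> P s M \<and> 0 \<le> R s M) \<and>
    (\<forall>s\<ge>1. \<forall>M\<ge>1. \<forall>a \<mu>.
      wiener_continuous 1 (univariate a) \<and> torus_fun 1 (univariate \<mu>) \<longrightarrow>
      (let v = run (\<A> s M) (\<lambda>t. a t + \<mu> t);
           \<Omega> = {\<omega> \<in> freq_band M. norm (dft M a \<omega>) > T s M a \<mu>};
           e = (\<lambda>\<omega>. dft M a \<omega> - Poly_Mapping.lookup v \<omega>)
       in Poly_Mapping.keys v \<subseteq> freq_band M \<and> card (Poly_Mapping.keys v) \<le> s \<and>
          (card \<Omega> \<le> s \<longrightarrow> \<Omega> \<subseteq> Poly_Mapping.keys v) \<and>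
          linf_norm (Poly_Mapping.keys v) e \<le> Einf s M a \<mu> \<and> Einf s M a \<mu> < T s M a \<mu> \<and>
          l2_seq_norm (freq_band M) e \<le> E2 s M a \<mu>)) \<and>
    (\<exists>C. \<forall>s\<ge>1. \<forall>M\<ge>1. \<forall>a \<mu>.
      wiener_continuous 1 (univariate a) \<and> torus_fun 1 (univariate \<mu>) \<longrightarrow>
      real (evals (\<A> s M) (\<lambda>t. a t + \<mu> t)) \<le> C * P s M \<and>
      real (operations (\<A> s M) (\<lambda>t. a t + \<mu> t)) \<le> C * R s M)"


section \<open>Phase encoding\<close>

text \<open>The representative of \<open>m\<close> modulo \<open>N\<close> in \<open>freq_band N\<close>.\<close>

definition centered_mod :: "nat \<Rightarrow> int \<Rightarrow> int" where
  "centered_mod N m = (let h = \<lceil>real N / 2\<rceil> - 1 in (m + h) mod int N - h)"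

lemma centered_mod_cong: "[centered_mod N m = m] (mod int N)"
  unfolding centered_mod_def Let_def cong_def
  by (metis add_diff_cancel_right' mod_diff_left_eq)

lemma centered_mod_in_band:
  assumes "N \<ge> 1"
  shows "centered_mod N m \<in> freq_band N"
proof -
  define h where "h = \<lceil>real N / 2\<rceil>"
  have "h + \<lfloor>real N / 2\<rfloor> = int N"
    unfolding h_def by linarith
  moreover have "0 \<le> (m + (h - 1)) mod int N" "(m + (h - 1)) mod int N < int N"
    using assms by auto
  ultimately show ?thesis
    unfolding centered_mod_def freq_band_def Let_def h_def by auto
qed

text \<open>
  The phase determines the frequency component only modulo \<open>N\<close>.  Reducing the rounded value to
  \<open>freq_band N\<close> matters for even \<open>N\<close>: the component \<open>N / 2\<close> has phase \<open>pi\<close>, and a small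
  perturbation can move \<open>Arg\<close> close to \<open>- pi\<close>, which rounds to \<open>- N / 2\<close>.
\<close>

definition decode_component :: "nat \<Rightarrow> complex \<Rightarrow> complex \<Rightarrow> ('q, int) prog" where
  "decode_component N w w' = do {
     q \<leftarrow> step (w' / w);
     \<theta> \<leftarrow> step (Arg q);
     y \<leftarrow> step (real N * \<theta>);
     y' \<leftarrow> step (y / (2 * pi));
     m \<leftarrow> step (round y');
     step (centered_mod N m)
   }"

definition decode_freq ::
    "nat \<Rightarrow> nat \<Rightarrow> (int \<Rightarrow>\<^sub>0 complex) \<Rightarrow> (nat \<Rightarrow> (int \<Rightarrow>\<^sub>0 complex)) \<Rightarrow> int \<Rightarrow>
     ('q, nat \<Rightarrow> int) prog" where
  "decode_freq N d v vs \<omega> =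
     for_each [0..<d]
       (\<lambda>l k. do {
          w \<leftarrow> step (Poly_Mapping.lookup v \<omega>);
          w' \<leftarrow> step (Poly_Mapping.lookup (vs l) \<omega>);
          m \<leftarrow> decode_component N w w';
          step (k(l := m))
        })
       (\<lambda>_. undefined)"

definition dot_prog :: "nat \<Rightarrow> (nat \<Rightarrow> int) \<Rightarrow> (nat \<Rightarrow> int) \<Rightarrow> ('q, int) prog" where
  "dot_prog d k z =
     for_each [0..<d] (\<lambda>l acc. do { p \<leftarrow> step (k l * z l); step (acc + p) }) 0"

text \<open>Accessing the entry \<open>b\<^sub>k\<close> is charged \<open>d\<close> operations for reading the \<open>d\<close>-tuple \<open>k\<close>.\<close>

definition add_entry ::
    "nat \<Rightarrow> (nat \<Rightarrow> int) \<Rightarrow> complex \<Rightarrow> ((nat \<Rightarrow> int) \<Rightarrow>\<^sub>0 complex) \<Rightarrow>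
     ('q, (nat \<Rightarrow> int) \<Rightarrow>\<^sub>0 complex) prog" where
  "add_entry d k w b = do {
     _ \<leftarrow> for_each [0..<d] (\<lambda>_ _. Return ()) ();
     step (b + Poly_Mapping.single k w)
   }"

text \<open>
  Enumerating the support of \<open>v\<close> is free because sparse vectors are stored by their nonzero
  entries; the order only serves to make the program deterministic.
\<close>

definition phase_encoding ::
    "nat \<Rightarrow> nat \<Rightarrow> (nat \<Rightarrow> int) \<Rightarrow> nat \<Rightarrow> sft \<Rightarrow>
     (nat \<Rightarrow> real, (nat \<Rightarrow> int) \<Rightarrow>\<^sub>0 complex) prog" where
  "phase_encoding N d z M A = do {
     v \<leftarrow> sample_via (lattice_line d z) A;
     vs \<leftarrow> for_each [0..<d]
       (\<lambda>l vs. do {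
          v' \<leftarrow> sample_via (\<lambda>t. shift_point l (1 / real N) (lattice_line d z t)) A;
          step (vs(l := v'))
        })
       (\<lambda>_. 0);
     b\<^sub>0 \<leftarrow> step 0;
     for_each (sorted_list_of_set (Poly_Mapping.keys v))
       (\<lambda>\<omega> b. do {
          k \<leftarrow> decode_freq N d v vs \<omega>;
          m \<leftarrow> dot_prog d k z;
          ok \<leftarrow> step ([m = \<omega>] (mod int M));
          if ok then do {
            w \<leftarrow> step (Poly_Mapping.lookup v \<omega>);
            add_entry d k w b
          } else Return b
        })
       b\<^sub>0
   }"

definition phase_encoding_input ::
    "nat \<Rightarrow> nat \<Rightarrow> nat \<Rightarrow> nat \<Rightarrow> (nat \<Rightarrow> int) \<Rightarrow> (nat \<Rightarrow> int) set \<Rightarrow>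
     ((nat \<Rightarrow> real) \<Rightarrow> complex) \<Rightarrow> ((nat \<Rightarrow> real) \<Rightarrow> complex) \<Rightarrow> bool" where
  "phase_encoding_input d N s M z I f \<nu> \<longleftrightarrow>
    d \<ge> 1 \<and> N \<ge> 2 \<and> s \<ge> 1 \<and> M \<ge> 1 \<and>
    wiener_continuous d f \<and> torus_fun d \<nu> \<and>
    finite I \<and> I \<subseteq> ({..<d} \<rightarrow>\<^sub>E freq_band N) \<and>
    reconstructing d I z M"

text \<open>
  The pairs \<open>(a, \<mu>)\<close> of univariate functions and noises of the \<open>d + 1\<close> transforms, for samples
  of \<open>f + \<nu>\<close>: first the unshifted one, then the one with shift in coordinate \<open>l\<close>.  The function to
  be recovered is the part of \<open>f\<close> supported on \<open>I\<close>; the remainder of \<open>f\<close> counts as noise, as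
  its frequencies alias with those in \<open>I\<close> and are not controlled by a reconstructing lattice
  for \<open>I\<close>.
\<close>

definition sft_signal :: "nat \<Rightarrow> (nat \<Rightarrow> int) set \<Rightarrow> (nat \<Rightarrow> int) \<Rightarrow>
    ((nat \<Rightarrow> real) \<Rightarrow> complex) \<Rightarrow> real \<Rightarrow> complex" where
  "sft_signal d I z f = (\<lambda>t. fourier_part d I f (lattice_line d z t))"

definition sft_noise :: "nat \<Rightarrow> (nat \<Rightarrow> int) set \<Rightarrow> (nat \<Rightarrow> int) \<Rightarrow>
    ((nat \<Rightarrow> real) \<Rightarrow> complex) \<Rightarrow> ((nat \<Rightarrow> real) \<Rightarrow> complex) \<Rightarrow> real \<Rightarrow> complex" where
  "sft_noise d I z f \<nu> =
    (\<lambda>t. (f (lattice_line d z t) - fourier_part d I f (lattice_line d z t))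
       + \<nu> (lattice_line d z t))"

definition shifted_sft_signal :: "nat \<Rightarrow> nat \<Rightarrow> (nat \<Rightarrow> int) set \<Rightarrow> (nat \<Rightarrow> int) \<Rightarrow>
    ((nat \<Rightarrow> real) \<Rightarrow> complex) \<Rightarrow> nat \<Rightarrow> real \<Rightarrow> complex" where
  "shifted_sft_signal d N I z f l =
    (\<lambda>t. shift_op l (1 / real N) (fourier_part d I f) (lattice_line d z t))"

definition shifted_sft_noise :: "nat \<Rightarrow> nat \<Rightarrow> (nat \<Rightarrow> int) set \<Rightarrow> (nat \<Rightarrow> int) \<Rightarrow>
    ((nat \<Rightarrow> real) \<Rightarrow> complex) \<Rightarrow> ((nat \<Rightarrow> real) \<Rightarrow> complex) \<Rightarrow> nat \<Rightarrow> real \<Rightarrow> complex" where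
  "shifted_sft_noise d N I z f \<nu> l =
    (\<lambda>t. shift_op l (1 / real N) (\<lambda>x. (f x - fourier_part d I f x) + \<nu> x) (lattice_line d z t))"

end

theory Submission
  imports Defs
begin

text \<open>
  Sampled along the lattice, the \<open>I\<close>-part of \<open>f\<close> becomes a univariate trigonometric polynomial
  whose discrete Fourier transform \<open>a\<close> of length \<open>M\<close> has, for \<open>k \<in> I\<close>, the entry \<open>c\<^sub>k\<close> at the
  residue of \<open>k \<cdot> z\<close> and vanishes elsewhere; the shift by \<open>1 / N\<close> in coordinate \<open>l\<close> multiplies
  that entry by \<open>cis (2 \<pi> k\<^sub>l / N)\<close>.  If \<open>\<bar>c\<^sub>k\<bar> > \<beta>\<close>, both transforms recover the entry up to
  \<open>\<eta>inf\<close>, so the quotient of the recovered values differs from \<open>cis (2 \<pi> k\<^sub>l / N)\<close> by less than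
  \<open>sin (\<pi> / N)\<close>, its argument is off by less than \<open>\<pi> / N\<close>, and rounding returns \<open>k\<^sub>l\<close>.

  For the error, \<open>b\<close> minus the \<open>I\<close>-part of \<open>c\<close> splits into three pieces: the differences
  \<open>v\<^sub>\<omega> - a\<^sub>\<omega>\<close> at the decoded frequencies, controlled by \<open>\<eta>2\<close>; the entries \<open>a\<^sub>\<omega>\<close> decoded to a
  frequency outside \<open>I\<close>, of which there are at most \<open>s - card S\<^sub>\<beta>\<close>, each at most \<open>\<beta>\<close> in modulus;
  and the coefficients on \<open>I\<close> that were missed, none of which is in \<open>S\<^sub>\<beta>\<close>.
\<close>

section \<open>Cost of programs\<close>

lemma run_bind: "run (bind_prog p k) g = run (k (run p g)) g"
  by (induction p) auto

lemma evals_bind: "evals (bind_prog p k) g = evals p g + evals (k (run p g)) g"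
  by (induction p) auto

lemma operations_bind: "operations (bind_prog p k) g = operations p g + operations (k (run p g)) g"
  by (induction p) auto

lemma step_simps:
  "run (step r) g = r" "evals (step r) g = 0" "operations (step r) g = 1"
  by (simp_all add: step_def)

lemma sample_via_simps:
  "run (sample_via \<phi> p) g = run p (\<lambda>t. g (\<phi> t))"
  "evals (sample_via \<phi> p) g = evals p (\<lambda>t. g (\<phi> t))"
  "operations (sample_via \<phi> p) g = operations p (\<lambda>t. g (\<phi> t))"
  unfolding sample_via_def by (induction p) auto

lemmas prog_simps = run_bind evals_bind operations_bind step_simps sample_via_simps

lemma run_for_each:
  "run (for_each is body st) g = fold (\<lambda>i st. run (body i st) g) is st"
  by (induction "is" arbitrary: st) (auto simp: run_bind)

lemma evals_for_each:
  assumes "\<And>i st. i \<in> set is \<Longrightarrow> evals (body i st) g \<le> e"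
  shows "evals (for_each is body st) g \<le> length is * e"
  using assms
proof (induction "is" arbitrary: st)
  case (Cons i "is")
  show ?case
    using Cons.prems[of i st] Cons.IH[of "run (body i st) g"] Cons.prems
    by (auto simp: evals_bind intro!: add_mono)
qed simp

lemma evals_for_each_0:
  assumes "\<And>i st. evals (body i st) g = 0"
  shows "evals (for_each is body st) g = 0"
  using evals_for_each[of "is" body g 0 st] assms by simp

lemma operations_for_each:
  assumes "\<And>i st. i \<in> set is \<Longrightarrow> operations (body i st) g \<le> e"
  shows "operations (for_each is body st) g \<le> length is * (e + 1)"
  using assms
proof (induction "is" arbitrary: st)
  case (Cons i "is")
  have "operations (body i st) g \<le> e"
    "operations (for_each is body (run (body i st) g)) g \<le> length is * (e + 1)"
    using Cons by auto
  then show ?case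
    by (simp add: operations_bind)
qed simp

section \<open>Results and costs of the stages of phase encoding\<close>

lemma fold_fun_upd_upt: "fold (\<lambda>l h. h(l := r l)) [0..<d] u = (\<lambda>l. if l < d then r l else u l)"
  by (induction d) auto

text \<open>Closed form of the frequency that \<open>decode_freq\<close> computes. The loop starts
  from a table that is \<open>undefined\<close> everywhere, so its result is exactly this
  extensional function.\<close>

definition decoded ::
    "nat \<Rightarrow> nat \<Rightarrow> (int \<Rightarrow>\<^sub>0 complex) \<Rightarrow> (nat \<Rightarrow> (int \<Rightarrow>\<^sub>0 complex)) \<Rightarrow> int \<Rightarrow> nat \<Rightarrow> int" where
  "decoded N d v vs \<omega> = (\<lambda>l\<in>{..<d}. centered_mod N (round
     (real N * Arg (Poly_Mapping.lookup (vs l) \<omega> / Poly_Mapping.lookup v \<omega>) / (2 * pi))))"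

lemma decode_freq_simps:
  "run (decode_freq N d v vs \<omega>) g = decoded N d v vs \<omega>"
  "evals (decode_freq N d v vs \<omega>) g = 0"
  "operations (decode_freq N d v vs \<omega>) g \<le> 10 * d"
proof -
  show "run (decode_freq N d v vs \<omega>) g = decoded N d v vs \<omega>"
    unfolding decode_freq_def run_for_each decode_component_def decoded_def
    by (simp add: prog_simps fold_fun_upd_upt restrict_def)
  show "evals (decode_freq N d v vs \<omega>) g = 0"
    unfolding decode_freq_def decode_component_def
    by (rule evals_for_each_0) (simp add: prog_simps)
  show "operations (decode_freq N d v vs \<omega>) g \<le> 10 * d"
    unfolding decode_freq_def decode_component_def
    \<comment> \<open>Two lookups, six operations in \<open>decode_component\<close> and one update
      make nine; the loop charges one more per iteration.\<close>
    by (rule order_trans[OF operations_for_each[where e = 9]]) (simp_all add: prog_simps)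
qed

lemma dot_prog_simps:
  "run (dot_prog d k z) g = freq_dot d k z"
  "evals (dot_prog d k z) g = 0"
  "operations (dot_prog d k z) g \<le> 3 * d"
proof -
  have "fold (\<lambda>l acc. acc + k l * z l) [0..<d] 0 = freq_dot d k z"
    by (induction d) (auto simp: freq_dot_def)
  then show "run (dot_prog d k z) g = freq_dot d k z"
    unfolding dot_prog_def run_for_each by (simp add: prog_simps)
  show "evals (dot_prog d k z) g = 0"
    unfolding dot_prog_def by (rule evals_for_each_0) (simp add: prog_simps)
  show "operations (dot_prog d k z) g \<le> 3 * d"
    unfolding dot_prog_def
    by (rule order_trans[OF operations_for_each[where e = 2]]) (simp_all add: prog_simps)
qed

lemma add_entry_simps:
  "run (add_entry d k w b) g = b + Poly_Mapping.single k w"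
  "evals (add_entry d k w b) g = 0"
  "operations (add_entry d k w b) g \<le> d + 1"
proof -
  show "run (add_entry d k w b) g = b + Poly_Mapping.single k w"
    by (simp add: add_entry_def prog_simps)
  show "evals (add_entry d k w b) g = 0"
    by (simp add: add_entry_def prog_simps evals_for_each_0)
  show "operations (add_entry d k w b) g \<le> d + 1"
    using operations_for_each[of "[0..<d]" "\<lambda>_ _. Return ()" g 0]
    by (simp add: add_entry_def prog_simps)
qed

text \<open>Several \<omega> may decode to the same frequency, so an entry collects all accepted
  contributions. Distinctness of the list makes the sum over a set count each of them once.\<close>

lemma lookup_fold_single:
  assumes "distinct xs"
  shows "Poly_Mapping.lookup
      (fold (\<lambda>\<omega> b. if Q \<omega> then b + Poly_Mapping.single (K \<omega>) (w \<omega>) else b) xs b\<^sub>0) k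
    = Poly_Mapping.lookup b\<^sub>0 k + (\<Sum>\<omega> | \<omega> \<in> set xs \<and> Q \<omega> \<and> K \<omega> = k. w \<omega>)"
  using assms
proof (induction xs arbitrary: b\<^sub>0)
  case (Cons x xs)
  have *: "{\<omega> \<in> set (x # xs). Q \<omega> \<and> K \<omega> = k} =
      (if Q x \<and> K x = k then {x} else {}) \<union> {\<omega> \<in> set xs. Q \<omega> \<and> K \<omega> = k}"
    by auto
  have "(\<Sum>\<omega> | \<omega> \<in> set (x # xs) \<and> Q \<omega> \<and> K \<omega> = k. w \<omega>) =
      (if Q x \<and> K x = k then w x else 0) + (\<Sum>\<omega> | \<omega> \<in> set xs \<and> Q \<omega> \<and> K \<omega> = k. w \<omega>)"
    unfolding * using Cons.prems by (subst sum.union_disjoint) auto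
  with Cons show ?case
    by (auto simp: lookup_add lookup_single add.assoc)
qed simp

text \<open>The error analysis sees the output of the program only through this formula, which
  removes the loops and tables.\<close>

lemma lookup_run_phase_encoding:
  fixes A g d z N
  defines "v \<equiv> run A (\<lambda>t. g (lattice_line d z t))"
    and "vs \<equiv> \<lambda>l. run A (\<lambda>t. g (shift_point l (1 / real N) (lattice_line d z t)))"
  shows "Poly_Mapping.lookup (run (phase_encoding N d z M A) g) k =
    (\<Sum>\<omega> | \<omega> \<in> Poly_Mapping.keys v \<and> [freq_dot d (decoded N d v vs \<omega>) z = \<omega>] (mod int M) \<and>
        decoded N d v vs \<omega> = k. Poly_Mapping.lookup v \<omega>)"
proof -
  \<comment> \<open>The table of shifted transforms is zero from index \<open>d\<close> on; decoding
    reads only the entries below \<open>d\<close>.\<close>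
  have *: "decoded N d v (\<lambda>l. if l < d then vs l else 0) = decoded N d v vs"
    by (auto simp: decoded_def fun_eq_iff restrict_def)
  have "run (phase_encoding N d z M A) g = fold (\<lambda>\<omega> b.
      if [freq_dot d (decoded N d v vs \<omega>) z = \<omega>] (mod int M)
      then b + Poly_Mapping.single (decoded N d v vs \<omega>) (Poly_Mapping.lookup v \<omega>) else b)
      (sorted_list_of_set (Poly_Mapping.keys v)) 0"
    unfolding phase_encoding_def
    by (simp add: prog_simps run_for_each fold_fun_upd_upt decode_freq_simps dot_prog_simps
        add_entry_simps if_distrib[of "\<lambda>p. run p g"] *[unfolded v_def vs_def] v_def vs_def cong: if_cong)
  then show ?thesis
    by (simp add: lookup_fold_single)
qed

text \<open>Only the \<open>d + 1\<close> transforms evaluate the function; decoding, testing and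
  accumulating do not.\<close>

lemma evals_phase_encoding:
  assumes "evals A (\<lambda>t. g (lattice_line d z t)) \<le> e"
    and "\<And>l. l < d \<Longrightarrow> evals A (\<lambda>t. g (shift_point l (1 / real N) (lattice_line d z t))) \<le> e"
  shows "evals (phase_encoding N d z M A) g \<le> (d + 1) * e"
proof -
  have shifted: "evals (for_each [0..<d]
       (\<lambda>l vs. bind_prog (sample_via (\<lambda>t. shift_point l (1 / real N) (lattice_line d z t)) A)
          (\<lambda>v'. step (vs(l := v')))) (\<lambda>_. 0)) g \<le> d * e"
    by (rule order_trans[OF evals_for_each[where e = e]]) (simp_all add: prog_simps assms)
  show ?thesis
    unfolding phase_encoding_def
    using assms(1) shifted
    by (simp add: prog_simps evals_for_each_0 decode_freq_simps dot_prog_simps add_entry_simps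
        if_distrib[of "\<lambda>p. evals p g"] cong: if_cong)
qed

text \<open>Besides the transforms, the loop over the shifts costs \<open>2 * d\<close> and
  initialising the output costs 1. Each support element costs at most \<open>10 * d\<close> for
  decoding, \<open>3 * d\<close> for the inner product, 1 for the congruence test, 1 for the lookup,
  \<open>d + 1\<close> for the update and 1 for the iteration.\<close>

lemma operations_phase_encoding:
  assumes "operations A (\<lambda>t. g (lattice_line d z t)) \<le> e"
    and "\<And>l. l < d \<Longrightarrow> operations A (\<lambda>t. g (shift_point l (1 / real N) (lattice_line d z t))) \<le> e"
    and "card (Poly_Mapping.keys (run A (\<lambda>t. g (lattice_line d z t)))) \<le> s"
  shows "operations (phase_encoding N d z M A) g \<le> (d + 1) * e + 2 * d + 1 + s * (14 * d + 4)"
proof -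
  let ?vs = "for_each [0..<d]
       (\<lambda>l vs. bind_prog (sample_via (\<lambda>t. shift_point l (1 / real N) (lattice_line d z t)) A)
          (\<lambda>v'. step (vs(l := v')))) (\<lambda>_. 0)"
  let ?v = "run A (\<lambda>t. g (lattice_line d z t))"
  let ?body = "\<lambda>\<omega> b. bind_prog (decode_freq N d ?v (run ?vs g) \<omega>) (\<lambda>k.
      bind_prog (dot_prog d k z) (\<lambda>m. bind_prog (step ([m = \<omega>] (mod int M))) (\<lambda>ok.
      if ok then bind_prog (step (Poly_Mapping.lookup ?v \<omega>)) (\<lambda>w. add_entry d k w b) else Return b)))"
  have shifted: "operations ?vs g \<le> d * (e + 2)"
    by (rule order_trans[OF operations_for_each[where e = "e + 1"]]) (simp_all add: prog_simps assms)
  have body: "operations (?body \<omega> b) g \<le> 14 * d + 3" for \<omega> b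
    using decode_freq_simps(3)[of N d ?v "run ?vs g" \<omega> g]
      dot_prog_simps(3)[of d "decoded N d ?v (run ?vs g) \<omega>" z g]
      add_entry_simps(3)[of d "decoded N d ?v (run ?vs g) \<omega>" "Poly_Mapping.lookup ?v \<omega>" b g]
    by (simp add: prog_simps decode_freq_simps(1) dot_prog_simps(1))
  have "operations (for_each (sorted_list_of_set (Poly_Mapping.keys ?v)) ?body 0) g
      \<le> length (sorted_list_of_set (Poly_Mapping.keys ?v)) * (14 * d + 3 + 1)"
    by (rule operations_for_each) (rule body)
  also have "\<dots> \<le> s * (14 * d + 4)"
    using assms(3) by (intro mult_mono) auto
  finally have loop: "operations (for_each (sorted_list_of_set (Poly_Mapping.keys ?v)) ?body 0) g
      \<le> s * (14 * d + 4)" .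
  have "operations (phase_encoding N d z M A) g =
      operations A (\<lambda>t. g (lattice_line d z t)) + operations ?vs g + 1
      + operations (for_each (sorted_list_of_set (Poly_Mapping.keys ?v)) ?body 0) g"
    unfolding phase_encoding_def by (simp add: prog_simps cong: if_cong)
  with assms(1) shifted loop show ?thesis
    by (simp add: algebra_simps)
qed

section \<open>Trigonometric polynomials\<close>

lemma character_eq_cis: "character d k x = cis (2 * pi * (\<Sum>l<d. of_int (k l) * x l))"
  by (simp add: character_def cis_conv_exp mult_ac)

lemma cis_eq_1_iff: "cis (2 * pi * x) = 1 \<longleftrightarrow> x \<in> \<int>"
proof
  assume "cis (2 * pi * x) = 1"
  then have "exp (\<i> * of_real (2 * pi * x)) = 1"
    by (simp only: cis_conv_exp)
  then obtain n :: int where "2 * pi * x = of_int (2 * n) * pi"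
    unfolding exp_eq_1 by auto
  then show "x \<in> \<int>" by simp
qed (simp add: cis_multiple_2pi)

text \<open>Orthogonality of the characters: for \<open>n \<noteq> 0\<close> the antiderivative
  \<open>exp (c * t) / c\<close> takes the same value at 0 and at 1.\<close>

lemma integral_cis_period:
  "(\<integral>t. cis (2 * pi * of_int n * t) \<partial>restrict_space lborel {0..1}) = (if n = 0 then 1 else 0)"
proof (cases "n = 0")
  case True
  then have "(\<integral>t. cis (2 * pi * of_int n * t) \<partial>restrict_space lborel {0..1}) =
      (\<integral>t. indicator {0..1::real} t *\<^sub>R (1::complex) \<partial>lborel)"
    by (subst integral_restrict_space) simp_all
  also have "\<dots> = 1"
    by (subst integral_scaleR_left) simp_all
  finally show ?thesis
    using True by simp
next
  case False
  define c where "c = 2 * of_real pi * \<i> * of_int n"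
  define F where "F = (\<lambda>t::real. exp (c * of_real t) / c)"
  have c: "c \<noteq> 0" "cis (2 * pi * of_int n * t) = exp (c * of_real t)" for t
    using False by (simp_all add: c_def cis_conv_exp mult_ac)
  have "((\<lambda>w. exp (c * w) / c) has_field_derivative exp (c * of_real t)) (at (of_real t))" for t
    using c(1) by (auto intro!: derivative_eq_intros)
  then have "(F has_vector_derivative cis (2 * pi * of_int n * t)) (at t within {0..1})" for t
    unfolding F_def c(2) by (intro has_vector_derivative_real_field)
  then have "(\<integral>t. indicator {0..1} t *\<^sub>R cis (2 * pi * of_int n * t) \<partial>lborel) = F 1 - F 0"
    by (intro integral_FTC_Icc continuous_intros) auto
  also have "F 1 = F 0"
    using c(2)[of 1] cis_eq_1_iff[of "of_int n"] by (simp add: F_def)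
  finally show ?thesis
    using False by (simp add: integral_restrict_space)
qed

text \<open>The one-dimensional torus is a product over the singleton index set {0}; both facts
  carry integration over it back to the unit interval.\<close>

lemma
  fixes h :: "real \<Rightarrow> complex"
  assumes "continuous_on UNIV h"
  shows integrable_torus_measure_1: "integrable (torus_measure 1) (\<lambda>x. h (x 0))"
    and integral_torus_measure_1:
      "(\<integral>x. h (x 0) \<partial>torus_measure 1) = (\<integral>t. h t \<partial>restrict_space lborel {0..1})"
proof -
  let ?L = "restrict_space lborel {0..1::real}"
  have "emeasure ?L (space ?L) = 1"
    by (simp add: emeasure_restrict_space space_restrict_space)
  then interpret L: finite_measure ?L
    by (intro finite_measureI) simp
  interpret product_sigma_finite "\<lambda>_::nat. ?L"
    by unfold_locales
  have torus: "torus_measure 1 = PiM {0} (\<lambda>_. ?L)"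
    by (simp add: torus_measure_def lessThan_Suc)
  have h: "h \<in> borel_measurable ?L"
    using assms by (intro measurable_restrict_space1) (simp add: borel_measurable_continuous_onI)
  have "integrable lborel (\<lambda>t. indicator {0..1} t *\<^sub>R h t)"
    by (intro borel_integrable_compact) (auto intro: continuous_on_subset[OF assms])
  then have "integrable (distr (PiM {0::nat} (\<lambda>_. ?L)) ?L (\<lambda>x. x 0)) h"
    by (simp add: distr_singleton integrable_restrict_space)
  then show "integrable (torus_measure 1) (\<lambda>x. h (x 0))"
    unfolding torus by (rule integrable_distr[rotated]) simp
  show "(\<integral>x. h (x 0) \<partial>torus_measure 1) = (\<integral>t. h t \<partial>?L)"
    unfolding torus by (rule product_integral_singleton[OF h])
qed

lemma finite_support_imp_summable_on:
  fixes f :: "'a \<Rightarrow> real"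
  assumes "finite F" "F \<subseteq> A" "\<And>x. x \<in> A - F \<Longrightarrow> f x = 0"
  shows "f summable_on A"
  using summable_on_cong_neutral[of A F f f] assms by auto

text \<open>Sparse transforms are specified for functions with this property only; the lemma makes
  their guarantees available for the sampled signals.\<close>

lemma wiener_continuous_trig_poly:
  fixes C :: "'k \<Rightarrow> complex" and m :: "'k \<Rightarrow> int"
  assumes "finite I"
  shows "wiener_continuous 1 (univariate (\<lambda>t. \<Sum>k\<in>I. C k * cis (2 * pi * of_int (m k) * t)))"
    (is "wiener_continuous 1 (univariate ?a)")
proof -
  have periodic: "cis (2 * pi * of_int n * (t + 1)) = cis (2 * pi * of_int n * t)" for n t
    using cis_eq_1_iff[of "of_int n"] by (simp add: distrib_left flip: cis_mult)
  have cont: "continuous_on UNIV ?a"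
    by (intro continuous_intros)
  \<comment> \<open>The exponents \<open>m k\<close> may coincide, so a Fourier coefficient is a sum
    over all \<open>k\<close> with the given exponent. It vanishes unless \<open>n 0\<close> is one
    of these finitely many exponents.\<close>
  have coeff: "fourier_coeff 1 (univariate ?a) n = (\<Sum>k\<in>I. C k * (if m k = n 0 then 1 else 0))" for n
  proof -
    have "fourier_coeff 1 (univariate ?a) n =
        (\<integral>x. (\<Sum>k\<in>I. C k * cis (2 * pi * of_int (m k - n 0) * x 0)) \<partial>torus_measure 1)"
      unfolding fourier_coeff_def univariate_def character_eq_cis sum_distrib_right
      by (intro Bochner_Integration.integral_cong sum.cong refl)
        (simp add: cis_mult algebra_simps)
    also have "\<dots> = (\<Sum>k\<in>I. C k * (\<integral>x. cis (2 * pi * of_int (m k - n 0) * x 0) \<partial>torus_measure 1))"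
      by (subst Bochner_Integration.integral_sum)
        (auto intro!: integrable_mult_right integrable_torus_measure_1
          [of "\<lambda>t. cis (2 * pi * of_int (m _ - n 0) * t)", simplified] continuous_intros)
    also have "\<dots> = (\<Sum>k\<in>I. C k * (if m k = n 0 then 1 else 0))"
      by (intro sum.cong refl arg_cong2[of _ _ _ _ "(*)"], subst integral_torus_measure_1)
        (auto intro!: continuous_intros simp only: integral_cis_period right_minus_eq)
    finally show ?thesis .
  qed
  have "(\<lambda>n. norm (fourier_coeff 1 (univariate ?a) n)) summable_on freqs 1"
  proof (rule finite_support_imp_summable_on)
    show "finite ({..<1::nat} \<rightarrow>\<^sub>E m ` I)"
      using assms by (intro finite_PiE) auto
    show "({..<1} \<rightarrow>\<^sub>E m ` I) \<subseteq> freqs 1"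
      by (auto simp: freqs_def)
    fix n assume n: "n \<in> freqs 1 - ({..<1} \<rightarrow>\<^sub>E m ` I)"
    then have "n 0 \<notin> m ` I"
      by (auto simp: freqs_def PiE_iff)
    then have "m k \<noteq> n 0" if "k \<in> I" for k
      using that by force
    then show "norm (fourier_coeff 1 (univariate ?a) n) = 0"
      unfolding coeff by (auto intro!: sum.neutral)
  qed
  moreover have "continuous_on ({..<1} \<rightarrow>\<^sub>E UNIV) (univariate ?a)"
    unfolding univariate_def
    by (intro continuous_intros continuous_on_subset[OF continuous_on_product_coordinates] subset_UNIV)
  ultimately show ?thesis
    using integrable_torus_measure_1[OF cont]
    unfolding wiener_continuous_def by (simp add: torus_fun_def univariate_def periodic)
qed

text \<open>A geometric sum with ratio \<open>q\<close>, where \<open>q ^ M = 1\<close>: it vanishes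
  unless \<open>q = 1\<close>, which happens exactly when \<open>M\<close> divides
  \<open>n\<close>.\<close>

lemma sum_roots_of_unity:
  assumes "M \<ge> 1"
  shows "(\<Sum>j<M. cis (2 * pi * of_int n * real j / real M)) = (if int M dvd n then of_nat M else 0)"
proof -
  define q where "q = cis (2 * pi * (of_int n / real M))"
  have "cis (2 * pi * of_int n * real j / real M) = q ^ j" for j
    unfolding q_def Complex.DeMoivre by (rule arg_cong[of _ _ cis]) simp
  then have "(\<Sum>j<M. cis (2 * pi * of_int n * real j / real M)) = (\<Sum>j<M. q ^ j)"
    by simp
  moreover have "q ^ M = 1"
    unfolding q_def Complex.DeMoivre using assms cis_eq_1_iff[of "of_int n"] by simp
  moreover have "q = 1 \<longleftrightarrow> int M dvd n"
    unfolding q_def cis_eq_1_iff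
  proof
    assume "of_int n / real M \<in> \<int>"
    then obtain i where "of_int n / real M = of_int i" by (auto elim: Ints_cases)
    then have "of_int n = (of_int (i * int M) :: real)" using assms by (simp add: field_simps)
    then show "int M dvd n" unfolding of_int_eq_iff by simp
  qed (use assms in auto)
  ultimately show ?thesis
    by (simp add: sum_gp_strict)
qed

text \<open>Aliasing: at the points \<open>j / M\<close>, exponents that agree modulo
  \<open>M\<close> cannot be told apart, and the sum of roots of unity removes all others.\<close>

lemma dft_trig_poly:
  assumes "finite I" "M \<ge> 1"
  shows "dft M (\<lambda>t. \<Sum>k\<in>I. C k * cis (2 * pi * of_int (m k) * t)) \<omega> =
    (\<Sum>k | k \<in> I \<and> [m k = \<omega>] (mod int M). C k)"
proof -
  have e: "exp (- 2 * of_real pi * \<i> * of_int \<omega> * of_nat j / of_nat M) =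
      cis (- (2 * pi * of_int \<omega> * real j / real M))" for j
    by (simp add: cis_conv_exp mult_ac)
  have "cis (2 * pi * of_int (m k) * (real j / real M)) *
      cis (- (2 * pi * of_int \<omega> * real j / real M)) =
      cis (2 * pi * of_int (m k - \<omega>) * real j / real M)" for j k
    unfolding cis_mult by (simp add: diff_divide_distrib algebra_simps)
  then have "dft M (\<lambda>t. \<Sum>k\<in>I. C k * cis (2 * pi * of_int (m k) * t)) \<omega> =
      (1 / of_nat M) * (\<Sum>j<M. \<Sum>k\<in>I. C k * cis (2 * pi * of_int (m k - \<omega>) * real j / real M))"
    unfolding dft_def sum_distrib_right e
    by (simp add: mult.assoc)
  also have "\<dots> = (\<Sum>k\<in>I. C k * ((\<Sum>j<M. cis (2 * pi * of_int (m k - \<omega>) * real j / real M)) / of_nat M))"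
    by (subst sum.swap) (simp add: sum_distrib_left sum_distrib_right sum_divide_distrib mult_ac)
  also have "\<dots> = (\<Sum>k\<in>I. if [m k = \<omega>] (mod int M) then C k else 0)"
    using assms by (intro sum.cong refl, subst sum_roots_of_unity) (simp_all add: cong_iff_dvd_diff)
  finally show ?thesis
    using assms by (simp add: sum.If_cases Int_def)
qed

section \<open>Decoding a frequency from a phase\<close>

text \<open>The band is a half-open interval of length \<open>N\<close>, so two of its elements
  differ by less than \<open>N\<close>.\<close>

lemma freq_band_cong_unique:
  assumes "x \<in> freq_band N" "y \<in> freq_band N" "[x = y] (mod int N)"
  shows "x = y"
proof -
  have "\<bar>x - y\<bar> < int N"
    using assms(1,2) unfolding freq_band_def by auto linarith+
  then show ?thesis
    using assms(3) dvd_imp_le_int[of "x - y" "int N"] by (force simp: cong_iff_dvd_diff)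
qed

lemma centered_mod_eqI:
  assumes "k \<in> freq_band N" "[m = k] (mod int N)" "N \<ge> 1"
  shows "centered_mod N m = k"
  using assms freq_band_cong_unique[OF centered_mod_in_band] centered_mod_cong cong_trans by blast

text \<open>The boundary rays of the sector of half-angle \<alpha> have distance sin \<alpha> from
  1, so the open disc of that radius around 1 stays inside the sector.\<close>

lemma abs_Arg_less:
  assumes "norm (u - 1) < sin \<alpha>" "0 < \<alpha>" "\<alpha> \<le> pi / 2"
  shows "u \<noteq> 0" "\<bar>Arg u\<bar> < \<alpha>"
proof -
  have "norm (u - 1) < 1"
    using assms(1) sin_le_one[of \<alpha>] by linarith
  then have "Re u > 0"
    using abs_Re_le_cmod[of "u - 1"] by simp
  then show u: "u \<noteq> 0" by auto
  have half: "\<bar>Arg u\<bar> < pi / 2"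
    using \<open>Re u > 0\<close> Arg_Re_pos by blast
  \<comment> \<open>Rotation by \<open>- Arg u\<close> moves \<open>u\<close> onto the positive real
    axis, so the rotated \<open>u - 1\<close> has imaginary part \<open>sin (Arg u)\<close>.\<close>
  have "u * cis (- Arg u) = of_real (norm u) * (cis (Arg u) * cis (- Arg u))"
    using rcis_cmod_Arg[of u] by (simp add: rcis_def mult.assoc[symmetric])
  then have "u * cis (- Arg u) = of_real (norm u)"
    by (simp add: cis_mult)
  then have "\<bar>sin (Arg u)\<bar> = \<bar>Im ((u - 1) * cis (- Arg u))\<bar>"
    by (simp add: left_diff_distrib)
  also have "\<dots> \<le> norm (u - 1)"
    using abs_Im_le_cmod[of "(u - 1) * cis (- Arg u)"] by (simp add: norm_mult)
  finally have "sin \<bar>Arg u\<bar> < sin \<alpha>"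
    using assms(1) by (cases "Arg u \<ge> 0") auto
  then show "\<bar>Arg u\<bar> < \<alpha>"
    using sin_mono_less_eq[of "\<bar>Arg u\<bar>" \<alpha>] half assms(2,3) by auto
qed

text \<open>Undoing the rotation leaves a number \<open>u\<close> close to 1 with argument below
  \<open>pi / N\<close> in modulus, which after scaling is an error below 1/2 in the integer to be
  rounded.\<close>

lemma phase_decoding:
  assumes "N \<ge> 2" "k \<in> freq_band N"
    and "norm (w - cis (2 * pi * of_int k / real N)) < sin (pi / real N)"
  shows "centered_mod N (round (real N * Arg w / (2 * pi))) = k"
proof -
  define u where "u = w * cis (- (2 * pi * of_int k / real N))"
  have "norm (u - 1) = norm ((w - cis (2 * pi * of_int k / real N)) * cis (- (2 * pi * of_int k / real N)))"
    by (simp add: u_def left_diff_distrib cis_mult)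
  also have "\<dots> < sin (pi / real N)"
    using assms(3) by (simp add: norm_mult)
  finally have u: "u \<noteq> 0" "\<bar>Arg u\<bar> < pi / real N"
    using abs_Arg_less[of u "pi / real N"] assms(1) by (auto simp: field_simps)
  have w: "w = u * cis (2 * pi * of_int k / real N)"
    by (simp add: u_def cis_mult mult.assoc)
  with u have "w \<noteq> 0" by auto
  have "cis (Arg w) = cis (Arg u + 2 * pi * of_int k / real N)"
    using u \<open>w \<noteq> 0\<close> by (simp add: cis_Arg w sgn_mult flip: cis_mult)
  then have "exp (\<i> * of_real (Arg w)) = exp (\<i> * of_real (Arg u + 2 * pi * of_int k / real N))"
    by (simp only: cis_conv_exp)
  \<comment> \<open>The principal value \<open>Arg w\<close> may differ from the expected phase by
    \<open>j\<close> full turns. They shift the rounded value by \<open>N * j\<close>, which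
    \<open>centered_mod\<close> removes.\<close>
  then obtain j :: int where "\<i> * of_real (Arg w) =
      \<i> * of_real (Arg u + 2 * pi * of_int k / real N) + of_real (of_int (2 * j) * pi) * \<i>"
    unfolding exp_eq by auto
  then have "Arg w = Arg u + 2 * pi * of_int k / real N + of_int (2 * j) * pi"
    by (auto simp: complex_eq_iff)
  then have "real N * Arg w / (2 * pi) - of_int (k + int N * j) = real N * Arg u / (2 * pi)"
    using assms(1) by (simp add: field_simps)
  moreover have "\<bar>real N * Arg u / (2 * pi)\<bar> < 1 / 2"
    using u(2) assms(1) by (simp add: abs_mult field_simps)
  ultimately have "round (real N * Arg w / (2 * pi)) = k + int N * j"
    by (intro round_unique') simp
  then show ?thesis
    using assms(1,2) by (simp add: centered_mod_eqI cong_iff_dvd_diff)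
qed

section \<open>Norms of sequences\<close>

text \<open>Every term is at most the total sum \<open>?B\<close>, so the squares are dominated by
  \<open>?B\<close> times the terms.\<close>

lemma summable_on_norm_square:
  fixes c :: "'k \<Rightarrow> complex"
  assumes "(\<lambda>k. norm (c k)) summable_on J"
  shows "(\<lambda>k. (norm (c k))\<^sup>2) summable_on J"
proof (rule summable_on_comparison_test)
  let ?B = "\<Sum>\<^sub>\<infinity>k\<in>J. norm (c k)"
  show "(\<lambda>k. ?B * norm (c k)) summable_on J"
    by (intro summable_on_cmult_right assms)
  fix k assume "k \<in> J"
  then have "norm (c k) \<le> ?B"
    using finite_sum_le_infsum[OF assms, of "{k}"] by simp
  then show "(norm (c k))\<^sup>2 \<le> ?B * norm (c k)"
    unfolding power2_eq_square by (intro mult_right_mono) auto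
qed simp

lemma L2_set_neutral:
  assumes "finite U" "V \<subseteq> U" "\<And>k. k \<in> U - V \<Longrightarrow> f k = 0"
  shows "L2_set f U = L2_set f V"
  unfolding L2_set_def using assms by (intro arg_cong[of _ _ sqrt] sum.mono_neutral_right) auto

lemma L2_set_mono_set:
  assumes "finite U" "V \<subseteq> U"
  shows "L2_set f V \<le> L2_set f U"
  unfolding L2_set_def using assms by (intro real_sqrt_le_mono sum_mono2) auto

lemma l2_seq_norm_eq_L2_set:
  assumes "finite U" "U \<subseteq> J" "\<And>k. k \<in> J - U \<Longrightarrow> x k = 0"
  shows "l2_seq_norm J x = L2_set (\<lambda>k. norm (x k)) U"
proof -
  have "(\<Sum>\<^sub>\<infinity>k\<in>J. (norm (x k))\<^sup>2) = (\<Sum>\<^sub>\<infinity>k\<in>U. (norm (x k))\<^sup>2)"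
    using assms by (intro infsum_cong_neutral) auto
  with assms(1) show ?thesis
    by (simp add: l2_seq_norm_def L2_set_def)
qed

lemma L2_set_le_l2_seq_norm:
  assumes "(\<lambda>k. (norm (x k))\<^sup>2) summable_on J" "finite F" "F \<subseteq> J"
  shows "L2_set (\<lambda>k. norm (x k)) F \<le> l2_seq_norm J x"
  unfolding l2_seq_norm_def L2_set_def using assms by (intro real_sqrt_le_mono finite_sum_le_infsum) auto

text \<open>The finite triangle inequality bounds all partial sums by one constant, which gives both
  the summability of the sum of the sequences and the bound on its norm.\<close>

lemma l2_seq_norm_triangle:
  assumes x: "(\<lambda>k. (norm (x k))\<^sup>2) summable_on J" and y: "(\<lambda>k. (norm (y k))\<^sup>2) summable_on J"
  shows "l2_seq_norm J (\<lambda>k. x k + y k) \<le> l2_seq_norm J x + l2_seq_norm J y"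
proof -
  let ?B = "l2_seq_norm J x + l2_seq_norm J y"
  have B: "0 \<le> ?B"
    by (simp add: l2_seq_norm_def infsum_nonneg)
  have partial: "(\<Sum>k\<in>F. (norm (x k + y k))\<^sup>2) \<le> ?B\<^sup>2" if F: "finite F" "F \<subseteq> J" for F
  proof -
    have "sqrt (\<Sum>k\<in>F. (norm (x k + y k))\<^sup>2) = L2_set (\<lambda>k. norm (x k + y k)) F"
      by (simp add: L2_set_def)
    also have "\<dots> \<le> L2_set (\<lambda>k. norm (x k) + norm (y k)) F"
      by (intro L2_set_mono norm_triangle_ineq) auto
    also have "\<dots> \<le> L2_set (\<lambda>k. norm (x k)) F + L2_set (\<lambda>k. norm (y k)) F"
      by (rule L2_set_triangle_ineq)
    also have "\<dots> \<le> ?B"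
      using F x y by (intro add_mono L2_set_le_l2_seq_norm)
    finally show ?thesis
      using B by (simp add: real_sqrt_le_iff' sqrt_le_D)
  qed
  have "(\<lambda>k. (norm (x k + y k))\<^sup>2) summable_on J"
    using partial by (intro nonneg_bdd_above_summable_on bdd_aboveI2) auto
  then have "(\<Sum>\<^sub>\<infinity>k\<in>J. (norm (x k + y k))\<^sup>2) \<le> ?B\<^sup>2"
    using partial by (rule infsum_le_finite_sums)
  then show ?thesis
    using B by (simp add: l2_seq_norm_def real_le_lsqrt)
qed

lemma norm_le_linf_norm: "finite J \<Longrightarrow> k \<in> J \<Longrightarrow> norm (c k) \<le> linf_norm J c"
  unfolding linf_norm_def by (intro Max_ge) auto

lemma linf_norm_nonneg: "finite J \<Longrightarrow> 0 \<le> linf_norm J c"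
  unfolding linf_norm_def by (intro Max_ge) auto

section \<open>Error of the decoded coefficients\<close>

text \<open>No two elements of \<open>I\<close> share a residue, so a residue hit by
  \<open>I\<close> receives a single coefficient.\<close>

lemma aliased_sum:
  assumes "inj_on (\<lambda>k. \<sigma> k mod int M) I" "k \<in> I" "[\<sigma> k = \<omega>] (mod int M)"
  shows "(\<Sum>j | j \<in> I \<and> [\<sigma> j = \<omega>] (mod int M). C j) = C k"
proof -
  have "{j. j \<in> I \<and> [\<sigma> j = \<omega>] (mod int M)} = {k}"
    using assms by (auto simp: cong_def inj_on_def)
  then show ?thesis by simp
qed

text \<open>The splitting into three pieces, separated from the program: \<sigma> gives the residue
  of a frequency, \<open>a\<close> is the exact transform of the part on \<open>I\<close>,
  \<open>K\<close> is the decoding map and \<open>P\<close> the set of indices that pass the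
  congruence test. About phases it is only required that every element of \<open>S\<close> is
  decoded from an index in \<open>P\<close>.\<close>

lemma decoding_error:
  fixes v :: "int \<Rightarrow>\<^sub>0 complex" and \<sigma> :: "'k \<Rightarrow> int" and K :: "int \<Rightarrow> 'k"
    and a :: "int \<Rightarrow> complex" and b c :: "'k \<Rightarrow> complex" and s M :: nat
  defines "P \<equiv> {\<omega> \<in> Poly_Mapping.keys v. [\<sigma> (K \<omega>) = \<omega>] (mod int M)}"
  assumes I: "finite I" "I \<subseteq> J" "K ` P \<subseteq> J"
    and inj: "inj_on (\<lambda>k. \<sigma> k mod int M) I"
    and keys: "Poly_Mapping.keys v \<subseteq> freq_band M" "card (Poly_Mapping.keys v) \<le> s"
    and b: "\<And>k. b k = (\<Sum>\<omega> | \<omega> \<in> P \<and> K \<omega> = k. Poly_Mapping.lookup v \<omega>)"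
    and a: "\<And>\<omega>. a \<omega> = (\<Sum>k | k \<in> I \<and> [\<sigma> k = \<omega>] (mod int M). c k)"
    and S: "S \<subseteq> I" "S \<subseteq> K ` P"
    and small: "\<And>k. k \<in> I - S \<Longrightarrow> norm (c k) \<le> \<beta>" "0 \<le> \<beta>"
    and c: "(\<lambda>k. (norm (c k))\<^sup>2) summable_on J"
    and err: "l2_seq_norm (freq_band M) (\<lambda>\<omega>. a \<omega> - Poly_Mapping.lookup v \<omega>) \<le> \<eta>"
  shows "l2_seq_norm J (\<lambda>k. b k - c k) \<le> \<eta> + \<beta> * sqrt (real s - real (card S))
      + l2_seq_norm J (\<lambda>k. restrict_seq I c k - restrict_seq S c k)
      + l2_seq_norm J (\<lambda>k. c k - restrict_seq I c k)"
    and "card S \<le> s"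
proof -
  have finP: "finite P" and PM: "P \<subseteq> freq_band M"
    using keys(1) by (auto simp: P_def)
  have uniq: "\<omega> = \<omega>'" if "\<omega> \<in> P" "\<omega>' \<in> P" "[\<omega> = \<omega>'] (mod int M)" for \<omega> \<omega>'
    using that PM freq_band_cong_unique by blast
  have cong: "[\<sigma> (K \<omega>) = \<omega>] (mod int M)" if "\<omega> \<in> P" for \<omega>
    using that by (simp add: P_def)
  \<comment> \<open>The congruence test makes \<omega> recoverable from \<open>K \<omega>\<close>:
    it is the only element of the band with the residue of
    \<open>\<sigma> (K \<omega>)\<close>.\<close>
  have injK: "inj_on K P"
  proof (rule inj_onI)
    fix \<omega> \<omega>' assume "\<omega> \<in> P" "\<omega>' \<in> P" "K \<omega> = K \<omega>'"
    then show "\<omega> = \<omega>'"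
      using uniq cong[of \<omega>] cong[of \<omega>'] by (metis cong_sym cong_trans)
  qed
  have at_K: "(\<Sum>\<omega>' | \<omega>' \<in> P \<and> K \<omega>' = K \<omega>. h \<omega>') = h \<omega>" if "\<omega> \<in> P" for \<omega> and h :: "int \<Rightarrow> complex"
  proof -
    have "{\<omega>'. \<omega>' \<in> P \<and> K \<omega>' = K \<omega>} = {\<omega>}"
      using that injK by (auto simp: inj_on_def)
    then show ?thesis by simp
  qed
  have off_K: "{\<omega>. \<omega> \<in> P \<and> K \<omega> = k} = {}" if "k \<notin> K ` P" for k
    using that by auto
  \<comment> \<open>\<open>A\<close> is what \<open>b\<close> would be if the values of
    \<open>v\<close> on \<open>P\<close> were exact. The indices in \<open>bad\<close> pass the
    congruence test although they decode to a frequency outside \<open>I\<close>.\<close>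
  define A where "A = (\<lambda>k. \<Sum>\<omega> | \<omega> \<in> P \<and> K \<omega> = k. a \<omega>)"
  define bad where "bad = {\<omega> \<in> P. K \<omega> \<notin> I}"
  define U where "U = K ` P \<union> I"
  have U: "finite U" "U \<subseteq> J"
    using I finP by (auto simp: U_def)
  have a_good: "a \<omega> = c (K \<omega>)" if "\<omega> \<in> P" "K \<omega> \<in> I" for \<omega>
    unfolding a using aliased_sum[OF inj] that cong by blast
  \<comment> \<open>If some \<open>k\<close> in \<open>S\<close> had the residue of a bad \<omega>,
    the index decoded to \<open>k\<close> would be \<omega> itself, which decodes outside
    \<open>I\<close>. So \<open>a \<omega>\<close> is zero or a coefficient outside
    \<open>S\<close>.\<close>
  have a_bad: "norm (a \<omega>) \<le> \<beta>" if \<omega>: "\<omega> \<in> bad" for \<omega>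
  proof (cases "\<exists>k\<in>I. [\<sigma> k = \<omega>] (mod int M)")
    case True
    then obtain k where k: "k \<in> I" "[\<sigma> k = \<omega>] (mod int M)" by blast
    have "k \<notin> S"
    proof
      assume "k \<in> S"
      then obtain \<omega>' where \<omega>': "\<omega>' \<in> P" "k = K \<omega>'"
        using S(2) by blast
      then have "\<omega>' = \<omega>"
        using \<omega> k(2) cong[OF \<omega>'(1)] by (intro uniq) (auto simp: bad_def cong_def)
      with \<omega>' k(1) \<omega> show False
        by (simp add: bad_def)
    qed
    then show ?thesis
      unfolding a aliased_sum[OF inj k] using k small by auto
  next
    case False
    then have "{k. k \<in> I \<and> [\<sigma> k = \<omega>] (mod int M)} = {}" by blast
    then show ?thesis
      unfolding a using small(2) by (simp only: sum.empty norm_zero)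
  qed
  \<comment> \<open>All elements of \<open>S\<close> are decoded from good indices, which leaves at
    most \<open>s - card S\<close> bad ones.\<close>
  have "S \<subseteq> K ` (P - bad)"
    using S by (auto simp: bad_def)
  then have "card S \<le> card (P - bad)"
    using finP by (intro surj_card_le) simp_all
  moreover have "card (P - bad) = card P - card bad" "card bad \<le> card P"
    using finP by (auto simp: bad_def intro!: card_Diff_subset card_mono)
  moreover have "card P \<le> card (Poly_Mapping.keys v)"
    by (intro card_mono) (auto simp: P_def)
  ultimately have card: "card S + card bad \<le> s"
    using keys(2) by linarith
  then show "card S \<le> s" by simp

  \<comment> \<open>First piece: by injectivity of \<open>K\<close> it can be reindexed to the error
    of the transform on \<open>P\<close>.\<close>
  have "L2_set (\<lambda>k. norm (b k - A k)) U = L2_set (\<lambda>k. norm (b k - A k)) (K ` P)"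
    by (intro L2_set_neutral[OF U(1)]) (auto simp: U_def b A_def off_K)
  also have "\<dots> = L2_set (\<lambda>\<omega>. norm (a \<omega> - Poly_Mapping.lookup v \<omega>)) P"
    unfolding L2_set_def b A_def using injK
    by (simp add: sum.reindex at_K norm_minus_commute)
  also have "\<dots> \<le> L2_set (\<lambda>\<omega>. norm (a \<omega> - Poly_Mapping.lookup v \<omega>)) (freq_band M)"
    using PM by (intro L2_set_mono_set) (simp_all add: freq_band_def)
  also have "\<dots> = l2_seq_norm (freq_band M) (\<lambda>\<omega>. a \<omega> - Poly_Mapping.lookup v \<omega>)"
    by (intro l2_seq_norm_eq_L2_set[symmetric]) (auto simp: freq_band_def)
  finally have n1: "L2_set (\<lambda>k. norm (b k - A k)) U \<le> \<eta>"
    using err by linarith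

  \<comment> \<open>Second piece: outside \<open>I\<close> only the bad indices contribute.\<close>
  define x where "x = (\<lambda>k. if k \<in> I then 0 else A k)"
  have "L2_set (\<lambda>k. norm (x k)) U = L2_set (\<lambda>k. norm (x k)) (K ` bad)"
    by (intro L2_set_neutral[OF U(1)]) (auto simp: U_def x_def bad_def)
  also have "\<dots> \<le> L2_set (\<lambda>_. \<beta>) (K ` bad)"
    using a_bad small(2) by (intro L2_set_mono) (auto simp: x_def A_def bad_def at_K)
  also have "\<dots> = sqrt (real (card bad)) * \<beta>"
    using small(2) injK by (subst L2_set_constant, subst card_image)
      (auto simp: bad_def intro: inj_on_subset)
  also have "\<dots> \<le> \<beta> * sqrt (real s - real (card S))"
    using small(2) card by (simp add: mult.commute mult_left_mono)
  finally have n2: "L2_set (\<lambda>k. norm (x k)) U \<le> \<beta> * sqrt (real s - real (card S))" .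

  \<comment> \<open>Third piece: at decoded frequencies in \<open>I\<close> the value of
    \<open>A\<close> is the exact coefficient, so only the missed frequencies remain, and these
    avoid \<open>S\<close>.\<close>
  define y where "y = (\<lambda>k. if k \<in> I then A k - c k else 0)"
  have "norm (y k) \<le> norm (restrict_seq I c k - restrict_seq S c k)" for k
  proof (cases "k \<in> K ` P")
    case True
    then obtain \<omega> where \<omega>: "\<omega> \<in> P" "k = K \<omega>" by blast
    then have "A k = a \<omega>"
      by (simp only: A_def at_K)
    with \<omega> show ?thesis
      by (simp add: y_def a_good)
  next
    case False
    then have "k \<notin> S" using S by auto
    with False show ?thesis
      by (auto simp: y_def A_def off_K restrict_seq_def)
  qed
  then have "L2_set (\<lambda>k. norm (y k)) U
      \<le> L2_set (\<lambda>k. norm (restrict_seq I c k - restrict_seq S c k)) U"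
    by (intro L2_set_mono) auto
  also have "\<dots> = l2_seq_norm J (\<lambda>k. restrict_seq I c k - restrict_seq S c k)"
    using U S by (intro l2_seq_norm_eq_L2_set[symmetric]) (auto simp: restrict_seq_def U_def)
  finally have n3: "L2_set (\<lambda>k. norm (y k)) U
      \<le> l2_seq_norm J (\<lambda>k. restrict_seq I c k - restrict_seq S c k)" .

  have off_U: "b k - restrict_seq I c k = 0" if "k \<in> J - U" for k
    using that by (auto simp: U_def b off_K restrict_seq_def)
  have "l2_seq_norm J (\<lambda>k. b k - restrict_seq I c k) = L2_set (\<lambda>k. norm (b k - restrict_seq I c k)) U"
    by (intro l2_seq_norm_eq_L2_set U off_U)
  also have "\<dots> \<le> L2_set (\<lambda>k. norm (b k - A k) + (norm (x k) + norm (y k))) U"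
  proof (intro L2_set_mono norm_ge_zero)
    fix k
    have "b k - restrict_seq I c k = (b k - A k) + (x k + y k)"
      by (simp add: x_def y_def restrict_seq_def)
    then show "norm (b k - restrict_seq I c k) \<le> norm (b k - A k) + (norm (x k) + norm (y k))"
      by (metis add_left_mono norm_triangle_ineq norm_triangle_le)
  qed
  also have "\<dots> \<le> L2_set (\<lambda>k. norm (b k - A k)) U
      + (L2_set (\<lambda>k. norm (x k)) U + L2_set (\<lambda>k. norm (y k)) U)"
    by (intro order_trans[OF L2_set_triangle_ineq] add_left_mono L2_set_triangle_ineq)
  finally have on_I: "l2_seq_norm J (\<lambda>k. b k - restrict_seq I c k) \<le> \<eta>
      + \<beta> * sqrt (real s - real (card S))
      + l2_seq_norm J (\<lambda>k. restrict_seq I c k - restrict_seq S c k)"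
    using n1 n2 n3 by linarith
  have "(\<lambda>k. (norm (b k - restrict_seq I c k))\<^sup>2) summable_on J"
    using off_U by (intro finite_support_imp_summable_on[OF U]) simp
  moreover have "(\<lambda>k. (norm (restrict_seq I c k - c k))\<^sup>2) summable_on J"
    by (rule summable_on_comparison_test[OF c]) (auto simp: restrict_seq_def)
  ultimately have "l2_seq_norm J (\<lambda>k. (b k - restrict_seq I c k) + (restrict_seq I c k - c k))
      \<le> l2_seq_norm J (\<lambda>k. b k - restrict_seq I c k) + l2_seq_norm J (\<lambda>k. restrict_seq I c k - c k)"
    by (rule l2_seq_norm_triangle)
  moreover have "l2_seq_norm J (\<lambda>k. restrict_seq I c k - c k) = l2_seq_norm J (\<lambda>k. c k - restrict_seq I c k)"
    by (simp add: l2_seq_norm_def norm_minus_commute)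
  ultimately show "l2_seq_norm J (\<lambda>k. b k - c k) \<le> \<eta> + \<beta> * sqrt (real s - real (card S))
      + l2_seq_norm J (\<lambda>k. restrict_seq I c k - restrict_seq S c k)
      + l2_seq_norm J (\<lambda>k. c k - restrict_seq I c k)"
    using on_I by simp
qed

section \<open>The transforms of the algorithm\<close>

text \<open>Integer frequencies make characters periodic; this discards the fractional parts in
  \<open>lattice_line\<close> and \<open>shift_point\<close>.\<close>

lemma character_cong:
  assumes "\<And>l. l < d \<Longrightarrow> x l - y l \<in> \<int>"
  shows "character d k x = character d k y"
proof -
  let ?X = "\<Sum>l<d. of_int (k l) * x l" and ?Y = "\<Sum>l<d. of_int (k l) * y l"
  have "?X - ?Y = (\<Sum>l<d. of_int (k l) * (x l - y l))"
    by (simp add: right_diff_distrib sum_subtractf)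
  then have "?X - ?Y \<in> \<int>"
    using assms by (auto intro!: Ints_sum Ints_mult)
  then have "cis (2 * pi * ?Y) * cis (2 * pi * (?X - ?Y)) = cis (2 * pi * ?Y)"
    by (simp add: cis_eq_1_iff)
  then show ?thesis
    unfolding character_eq_cis cis_mult by (simp add: right_diff_distrib)
qed

lemma frac_diff_Ints: "frac x - x \<in> \<int>"
  by (simp add: frac_def)

text \<open>Along the line in direction \<open>z\<close>, the character of \<open>k\<close> becomes
  the univariate character of frequency k \<cdot> z.\<close>

lemma sft_signal_eq:
  "sft_signal d I z f =
    (\<lambda>t. \<Sum>k\<in>I. fourier_coeff d f k * cis (2 * pi * of_int (freq_dot d k z) * t))"
proof -
  have "character d k (lattice_line d z t) = cis (2 * pi * of_int (freq_dot d k z) * t)" for k t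
  proof -
    have "character d k (lattice_line d z t) = character d k (\<lambda>l. t * of_int (z l))"
      by (rule character_cong) (simp add: lattice_line_def frac_diff_Ints)
    also have "\<dots> = cis (2 * pi * of_int (freq_dot d k z) * t)"
      by (simp add: character_eq_cis freq_dot_def sum_distrib_left sum_distrib_right mult_ac)
    finally show ?thesis .
  qed
  then show ?thesis
    by (simp add: sft_signal_def fourier_part_def)
qed

lemma shifted_sft_signal_eq:
  assumes "l < d"
  shows "shifted_sft_signal d N I z f l = (\<lambda>t. \<Sum>k\<in>I.
    (fourier_coeff d f k * cis (2 * pi * of_int (k l) / real N)) * cis (2 * pi * of_int (freq_dot d k z) * t))"
proof -
  have "character d k (shift_point l (1 / real N) (lattice_line d z t)) =
      cis (2 * pi * of_int (k l) / real N) * cis (2 * pi * of_int (freq_dot d k z) * t)" for k t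
  proof -
    let ?y = "\<lambda>i. t * of_int (z i) + (if i = l then 1 / real N else 0)"
    \<comment> \<open>In coordinate \<open>l\<close> the fractional part is taken twice, by the
      lattice and by the shift.\<close>
    have shift: "frac (frac x + e) - (x + e) \<in> \<int>" for x e :: real
      using Ints_add[OF frac_diff_Ints[of "frac x + e"] frac_diff_Ints[of x]] by (simp add: algebra_simps)
    have "character d k (shift_point l (1 / real N) (lattice_line d z t)) = character d k ?y"
      using assms
      by (intro character_cong) (auto simp: shift_point_def lattice_line_def frac_diff_Ints shift)
    moreover have "(\<Sum>i<d. of_int (k i) * ?y i) = of_int (k l) / real N + of_int (freq_dot d k z) * t"
    proof -
      have "of_int (k i) * ?y i = of_int (k i * z i) * t + (if i = l then of_int (k l) / real N else 0)" for i
        by (simp add: algebra_simps)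
      then show ?thesis
        using assms by (simp add: sum.distrib freq_dot_def sum_distrib_right)
    qed
    ultimately show ?thesis
      by (simp add: character_eq_cis cis_mult distrib_left mult.assoc)
  qed
  then show ?thesis
    by (simp add: shifted_sft_signal_def shift_op_def fourier_part_def mult.assoc)
qed

lemma lattice_line_periodic: "lattice_line d z (t + 1) = lattice_line d z t"
proof -
  have "frac (x + of_int n) = frac x" for x :: real and n
    by (simp add: frac_def)
  then show ?thesis
    by (simp add: lattice_line_def distrib_right)
qed

text \<open>The periodicity comes from the integer vector \<open>z\<close>, whatever
  \<open>h\<close> is, and so holds for the noises built from the remainder of
  \<open>f\<close>.\<close>

lemma torus_fun_lattice_line: "torus_fun 1 (univariate (\<lambda>t. h (lattice_line d z t)))"
  by (simp add: torus_fun_def univariate_def lattice_line_periodic)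

text \<open>Restates the specification of the transform in terms of the coefficients
  \<open>C k\<close>, so that one lemma serves the unshifted signal and all shifted ones.\<close>

lemma sft_guarantees:
  fixes \<sigma> :: "'k \<Rightarrow> int" and C :: "'k \<Rightarrow> complex"
  assumes sft: "noise_robust_sft \<A> T Einf E2 P R" and "s \<ge> 1" "M \<ge> 1"
    and a: "a = (\<lambda>t. \<Sum>k\<in>I. C k * cis (2 * pi * of_int (\<sigma> k) * t))"
    and I: "finite I" "inj_on (\<lambda>k. \<sigma> k mod int M) I"
    and noise: "torus_fun 1 (univariate \<mu>)"
    and sparse: "card {k \<in> I. C k \<noteq> 0 \<and> norm (C k) > T s M a \<mu>} \<le> s"
    and g: "\<And>t. g t = a t + \<mu> t"
  shows "Poly_Mapping.keys (run (\<A> s M) g) \<subseteq> freq_band M"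
    and "card (Poly_Mapping.keys (run (\<A> s M) g)) \<le> s"
    and "0 \<le> Einf s M a \<mu>" "Einf s M a \<mu> < T s M a \<mu>"
    and "l2_seq_norm (freq_band M) (\<lambda>\<omega>. (\<Sum>k | k \<in> I \<and> [\<sigma> k = \<omega>] (mod int M). C k)
      - Poly_Mapping.lookup (run (\<A> s M) g) \<omega>) \<le> E2 s M a \<mu>"
    and "\<And>k. k \<in> I \<Longrightarrow> norm (C k) > T s M a \<mu> \<Longrightarrow>
      centered_mod M (\<sigma> k) \<in> Poly_Mapping.keys (run (\<A> s M) g) \<and>
      norm (C k - Poly_Mapping.lookup (run (\<A> s M) g) (centered_mod M (\<sigma> k))) \<le> Einf s M a \<mu>"
proof -
  define v where "v = run (\<A> s M) g"
  let ?\<tau> = "T s M a \<mu>" and ?\<eta> = "Einf s M a \<mu>"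
  define \<Omega> where "\<Omega> = {\<omega> \<in> freq_band M. norm (dft M a \<omega>) > ?\<tau>}"
  have wiener: "wiener_continuous 1 (univariate a)"
    unfolding a using I(1) by (rule wiener_continuous_trig_poly)
  have "g = (\<lambda>t. a t + \<mu> t)"
    using g by auto
  moreover have "\<forall>s\<ge>1. \<forall>M\<ge>1. \<forall>a \<mu>.
      wiener_continuous 1 (univariate a) \<and> torus_fun 1 (univariate \<mu>) \<longrightarrow>
      (let v = run (\<A> s M) (\<lambda>t. a t + \<mu> t);
           \<Omega> = {\<omega> \<in> freq_band M. norm (dft M a \<omega>) > T s M a \<mu>};
           e = (\<lambda>\<omega>. dft M a \<omega> - Poly_Mapping.lookup v \<omega>)
       in Poly_Mapping.keys v \<subseteq> freq_band M \<and> card (Poly_Mapping.keys v) \<le> s \<and>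
          (card \<Omega> \<le> s \<longrightarrow> \<Omega> \<subseteq> Poly_Mapping.keys v) \<and>
          linf_norm (Poly_Mapping.keys v) e \<le> Einf s M a \<mu> \<and> Einf s M a \<mu> < T s M a \<mu> \<and>
          l2_seq_norm (freq_band M) e \<le> E2 s M a \<mu>)"
    using sft unfolding noise_robust_sft_def by (elim conjE)
  ultimately have *: "Poly_Mapping.keys v \<subseteq> freq_band M" "card (Poly_Mapping.keys v) \<le> s"
      "card \<Omega> \<le> s \<longrightarrow> \<Omega> \<subseteq> Poly_Mapping.keys v"
      "linf_norm (Poly_Mapping.keys v) (\<lambda>\<omega>. dft M a \<omega> - Poly_Mapping.lookup v \<omega>) \<le> ?\<eta>"
      "?\<eta> < ?\<tau>"
      "l2_seq_norm (freq_band M) (\<lambda>\<omega>. dft M a \<omega> - Poly_Mapping.lookup v \<omega>) \<le> E2 s M a \<mu>"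
    using noise wiener \<open>s \<ge> 1\<close> \<open>M \<ge> 1\<close> by (simp_all add: Let_def v_def \<Omega>_def)
  have dft: "dft M a \<omega> = (\<Sum>k | k \<in> I \<and> [\<sigma> k = \<omega>] (mod int M). C k)" for \<omega>
    unfolding a using I(1) \<open>M \<ge> 1\<close> by (rule dft_trig_poly)
  have \<eta>: "0 \<le> ?\<eta>"
    using *(4) linf_norm_nonneg[of "Poly_Mapping.keys v"] by (meson finite_keys order_trans)
  \<comment> \<open>Since the tolerance is positive, a significant index must be the residue of some
    \<open>k\<close> in \<open>I\<close>, with \<open>C k\<close> as its entry. Sparsity of the
    coefficients thus bounds \<open>card \<Omega>\<close> and activates the recovery
    guarantee.\<close>
  have "\<Omega> \<subseteq> (\<lambda>k. centered_mod M (\<sigma> k)) ` {k \<in> I. C k \<noteq> 0 \<and> norm (C k) > ?\<tau>}"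
  proof
    fix \<omega> assume \<omega>: "\<omega> \<in> \<Omega>"
    obtain k where k: "k \<in> I" "[\<sigma> k = \<omega>] (mod int M)"
    proof (rule ccontr)
      assume "\<not> thesis"
      with that have "{k. k \<in> I \<and> [\<sigma> k = \<omega>] (mod int M)} = {}" by blast
      then have "dft M a \<omega> = 0" by (simp only: dft sum.empty)
      with \<omega> \<eta> *(5) show False by (simp add: \<Omega>_def)
    qed
    then have "norm (C k) > ?\<tau>"
      using \<omega> aliased_sum[OF I(2) k, of C] by (simp add: \<Omega>_def dft)
    moreover have "\<omega> = centered_mod M (\<sigma> k)"
      using \<omega> k(2) \<open>M \<ge> 1\<close> centered_mod_eqI[of \<omega> M "\<sigma> k"] by (simp add: \<Omega>_def)
    ultimately show "\<omega> \<in> (\<lambda>k. centered_mod M (\<sigma> k)) ` {k \<in> I. C k \<noteq> 0 \<and> norm (C k) > ?\<tau>}"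
      using k(1) \<eta> *(5) by (intro image_eqI[where x = k]) auto
  qed
  then have "card \<Omega> \<le> card {k \<in> I. C k \<noteq> 0 \<and> norm (C k) > ?\<tau>}"
    using I(1) by (intro surj_card_le) auto
  then have \<Omega>: "\<Omega> \<subseteq> Poly_Mapping.keys v"
    using sparse *(3) by linarith
  show "Poly_Mapping.keys (run (\<A> s M) g) \<subseteq> freq_band M"
    "card (Poly_Mapping.keys (run (\<A> s M) g)) \<le> s" "0 \<le> ?\<eta>" "?\<eta> < ?\<tau>"
    "l2_seq_norm (freq_band M) (\<lambda>\<omega>. (\<Sum>k | k \<in> I \<and> [\<sigma> k = \<omega>] (mod int M). C k)
      - Poly_Mapping.lookup (run (\<A> s M) g) \<omega>) \<le> E2 s M a \<mu>"
    using * \<eta> by (simp_all add: v_def dft)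
  fix k assume k: "k \<in> I" "norm (C k) > ?\<tau>"
  let ?\<omega> = "centered_mod M (\<sigma> k)"
  have \<omega>: "dft M a ?\<omega> = C k"
    unfolding dft using k(1) centered_mod_cong cong_sym by (intro aliased_sum[OF I(2)]) blast+
  then have "?\<omega> \<in> \<Omega>"
    using k(2) \<open>M \<ge> 1\<close> by (simp add: \<Omega>_def centered_mod_in_band)
  then have mem: "?\<omega> \<in> Poly_Mapping.keys v"
    using \<Omega> by blast
  have "norm (C k - Poly_Mapping.lookup v ?\<omega>) \<le> ?\<eta>"
    using norm_le_linf_norm[OF _ mem, of "\<lambda>\<omega>. dft M a \<omega> - Poly_Mapping.lookup v \<omega>"] *(4)
    by (simp add: \<omega>)
  with mem show "?\<omega> \<in> Poly_Mapping.keys (run (\<A> s M) g) \<and>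
      norm (C k - Poly_Mapping.lookup (run (\<A> s M) g) ?\<omega>) \<le> ?\<eta>"
    by (simp add: v_def)
qed

text \<open>The numerator of \<open>w' / w - u\<close> is at most 2\<eta> in modulus, and
  \<open>norm w\<close> is at least \<open>norm c - \<eta>\<close>, which exceeds 2\<eta>/r. With
  \<open>r = sin (pi / N)\<close> this is the origin of the factor 1 + 2/r in \<beta>.\<close>

lemma ratio_error:
  fixes c u w w' :: complex
  assumes "norm u = 1" "norm (c - w) \<le> \<eta>" "norm (c * u - w') \<le> \<eta>"
    and "norm c > \<eta>" "norm c > \<eta> * (1 + 2 / r)" "r > 0"
  shows "norm (w' / w - u) < r"
proof -
  have w: "norm w \<ge> norm c - \<eta>"
    using assms(2) norm_triangle_ineq2[of c w] by linarith
  then have "w \<noteq> 0" using assms(4) by auto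
  have "2 * \<eta> / r < norm w"
    using w assms(5) by (simp add: algebra_simps)
  then have "2 * \<eta> < r * norm w"
    using assms(6) by (simp add: field_simps)
  moreover have "norm (w' - u * w) \<le> \<eta> + \<eta>"
  proof -
    have "w' - u * w = u * (c - w) - (c * u - w')" by (simp add: algebra_simps)
    then have "norm (w' - u * w) \<le> norm (u * (c - w)) + norm (c * u - w')"
      by (metis norm_triangle_ineq4)
    also have "\<dots> \<le> \<eta> + \<eta>"
      using assms(1-3) by (simp add: norm_mult)
    finally show ?thesis .
  qed
  moreover have "w' / w - u = (w' - u * w) / w"
    using \<open>w \<noteq> 0\<close> by (simp add: field_simps)
  ultimately show ?thesis
    using \<open>w \<noteq> 0\<close> by (simp add: norm_divide divide_less_eq)
qed

section \<open>From the guarantees of the transforms to the error estimate\<close>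

lemma phase_encoding_accuracy:
  fixes \<A> :: "nat \<Rightarrow> nat \<Rightarrow> sft" and f \<nu> :: "(nat \<Rightarrow> real) \<Rightarrow> complex" and d N s M :: nat
    and z :: "nat \<Rightarrow> int" and I :: "(nat \<Rightarrow> int) set" and \<tau> \<eta>inf :: real
  defines "c \<equiv> fourier_coeff d f"
    and "b \<equiv> run (phase_encoding N d z M (\<A> s M)) (\<lambda>x. f x + \<nu> x)"
    and "\<beta> \<equiv> max \<tau> (\<eta>inf * (1 + 2 / sin (pi / real N)))"
  defines "S \<equiv> large_coeffs d I f \<beta>"
  assumes sft: "noise_robust_sft \<A> T Einf E2 P R"
    and input: "phase_encoding_input d N s M z I f \<nu>"
    and par: "T s M (sft_signal d I z f) (sft_noise d I z f \<nu>) = \<tau>"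
      "Einf s M (sft_signal d I z f) (sft_noise d I z f \<nu>) = \<eta>inf"
    and shifted: "\<forall>l<d. T s M (shifted_sft_signal d N I z f l) (shifted_sft_noise d N I z f \<nu> l) = \<tau> \<and>
        Einf s M (shifted_sft_signal d N I z f l) (shifted_sft_noise d N I z f \<nu> l) = \<eta>inf"
    and sparse: "card ({k \<in> freqs d. c k \<noteq> 0} \<inter> large_coeffs d I f \<tau>) \<le> s"
  shows "Poly_Mapping.keys b \<subseteq> ({..<d} \<rightarrow>\<^sub>E freq_band N)"
    and "card (Poly_Mapping.keys b) \<le> s"
    and "card (Poly_Mapping.keys (run (\<A> s M) (\<lambda>t. f (lattice_line d z t) + \<nu> (lattice_line d z t)))) \<le> s"
    and "l2_seq_norm (freqs d) (\<lambda>k. Poly_Mapping.lookup b k - c k)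
      \<le> E2 s M (sft_signal d I z f) (sft_noise d I z f \<nu>)
        + (\<beta> + \<eta>inf) * sqrt (max (real s - real (card S)) 0)
        + l2_seq_norm (freqs d) (\<lambda>k. restrict_seq I c k - restrict_seq S c k)
        + l2_seq_norm (freqs d) (\<lambda>k. c k - restrict_seq I c k)"
proof -
  have N: "N \<ge> 2" and s: "s \<ge> 1" and M: "M \<ge> 1" and f: "wiener_continuous d f"
    and I: "finite I" "I \<subseteq> ({..<d} \<rightarrow>\<^sub>E freq_band N)"
    and inj: "inj_on (\<lambda>k. freq_dot d k z mod int M) I"
    using input by (auto simp: phase_encoding_input_def reconstructing_def)
  have band: "({..<d} \<rightarrow>\<^sub>E freq_band N) \<subseteq> freqs d"
    unfolding freqs_def by (rule PiE_mono) simp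
  with I(2) have "I \<subseteq> freqs d"
    by blast
  define v where "v = run (\<A> s M) (\<lambda>t. f (lattice_line d z t) + \<nu> (lattice_line d z t))"
  define vs where "vs = (\<lambda>l. run (\<A> s M) (\<lambda>t. f (shift_point l (1 / real N) (lattice_line d z t))
      + \<nu> (shift_point l (1 / real N) (lattice_line d z t))))"
  define K where "K = decoded N d v vs"
  define Q where "Q = {\<omega> \<in> Poly_Mapping.keys v. [freq_dot d (K \<omega>) z = \<omega>] (mod int M)}"
  have b: "Poly_Mapping.lookup b k = (\<Sum>\<omega> | \<omega> \<in> Q \<and> K \<omega> = k. Poly_Mapping.lookup v \<omega>)" for k
    unfolding b_def lookup_run_phase_encoding Q_def K_def v_def vs_def
    by (intro sum.cong) auto
  have K: "K \<omega> \<in> {..<d} \<rightarrow>\<^sub>E freq_band N" for \<omega>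
    using N by (auto simp: K_def decoded_def centered_mod_in_band)
  have keys_b: "Poly_Mapping.keys b \<subseteq> K ` Q"
  proof
    fix k assume "k \<in> Poly_Mapping.keys b"
    then have "(\<Sum>\<omega> | \<omega> \<in> Q \<and> K \<omega> = k. Poly_Mapping.lookup v \<omega>) \<noteq> 0"
      by (simp add: in_keys_iff b)
    then have "{\<omega>. \<omega> \<in> Q \<and> K \<omega> = k} \<noteq> {}"
      by (metis sum.empty)
    then show "k \<in> K ` Q" by blast
  qed
  then show "Poly_Mapping.keys b \<subseteq> ({..<d} \<rightarrow>\<^sub>E freq_band N)"
    using K by blast

  have torus: "torus_fun 1 (univariate (sft_noise d I z f \<nu>))"
    unfolding sft_noise_def by (rule torus_fun_lattice_line)
  have torus_l: "torus_fun 1 (univariate (shifted_sft_noise d N I z f \<nu> l))" for l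
    unfolding shifted_sft_noise_def by (rule torus_fun_lattice_line)

  let ?\<sigma> = "\<lambda>k. freq_dot d k z"
  have support: "{k \<in> I. c k \<noteq> 0 \<and> norm (c k) > \<tau>} = {k \<in> freqs d. c k \<noteq> 0} \<inter> large_coeffs d I f \<tau>"
    using \<open>I \<subseteq> freqs d\<close> by (auto simp: large_coeffs_def c_def)
  note base = sft_guarantees[OF sft s M sft_signal_eq[of d I z f] I(1) inj torus, folded c_def,
      unfolded par support, OF sparse]
  have sample: "f (lattice_line d z t) + \<nu> (lattice_line d z t) =
      sft_signal d I z f t + sft_noise d I z f \<nu> t" for t
    by (simp add: sft_signal_def sft_noise_def)
  have keys_v: "Poly_Mapping.keys v \<subseteq> freq_band M" "card (Poly_Mapping.keys v) \<le> s"
    and \<eta>inf: "0 \<le> \<eta>inf" "\<eta>inf < \<tau>"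
    and err: "l2_seq_norm (freq_band M) (\<lambda>\<omega>. (\<Sum>k | k \<in> I \<and> [?\<sigma> k = \<omega>] (mod int M). c k)
      - Poly_Mapping.lookup v \<omega>) \<le> E2 s M (sft_signal d I z f) (sft_noise d I z f \<nu>)"
    and v: "\<And>k. k \<in> I \<Longrightarrow> norm (c k) > \<tau> \<Longrightarrow> centered_mod M (?\<sigma> k) \<in> Poly_Mapping.keys v \<and>
      norm (c k - Poly_Mapping.lookup v (centered_mod M (?\<sigma> k))) \<le> \<eta>inf"
    using base[OF sample] by (simp_all add: v_def)
  \<comment> \<open>The phase factors have modulus one, so each shifted signal has the same
    significant frequencies as the unshifted one.\<close>
  have vs: "norm (c k * cis (2 * pi * of_int (k l) / real N)
      - Poly_Mapping.lookup (vs l) (centered_mod M (?\<sigma> k))) \<le> \<eta>inf"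
    if l: "l < d" and k: "k \<in> I" "norm (c k) > \<tau>" for l k
  proof -
    have shifted_par: "T s M (shifted_sft_signal d N I z f l) (shifted_sft_noise d N I z f \<nu> l) = \<tau>"
      "Einf s M (shifted_sft_signal d N I z f l) (shifted_sft_noise d N I z f \<nu> l) = \<eta>inf"
      using shifted l by blast+
    let ?C = "\<lambda>k. c k * cis (2 * pi * of_int (k l) / real N)"
    have signal: "shifted_sft_signal d N I z f l =
        (\<lambda>t. \<Sum>k\<in>I. ?C k * cis (2 * pi * of_int (?\<sigma> k) * t))"
      unfolding c_def by (rule shifted_sft_signal_eq[OF l])
    have support_l: "{k \<in> I. ?C k \<noteq> 0 \<and> norm (?C k) > \<tau>} =
        {k \<in> freqs d. c k \<noteq> 0} \<inter> large_coeffs d I f \<tau>"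
      unfolding support[symmetric] by (simp add: norm_mult)
    have sample_l: "f (shift_point l (1 / real N) (lattice_line d z t)) + \<nu> (shift_point l (1 / real N) (lattice_line d z t))
        = shifted_sft_signal d N I z f l t + shifted_sft_noise d N I z f \<nu> l t" for t
      by (simp add: shifted_sft_signal_def shifted_sft_noise_def shift_op_def)
    have "centered_mod M (?\<sigma> k) \<in> Poly_Mapping.keys (vs l) \<and>
        norm (?C k - Poly_Mapping.lookup (vs l) (centered_mod M (?\<sigma> k))) \<le> \<eta>inf"
      using sft_guarantees(6)[OF sft s M signal I(1) inj torus_l[of l],
          unfolded shifted_par support_l, OF sparse sample_l k(1)] k(2)
      by (simp add: norm_mult vs_def)
    then show ?thesis by blast
  qed
  have sin_pos: "0 < sin (pi / real N)"
    using N by (intro sin_gt_zero) (auto simp: field_simps)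
  \<comment> \<open>Both bounds in \<beta> enter: exceeding \<tau> puts the index of
    \<open>k\<close> into the support of \<open>v\<close>, with errors at most
    \<open>\<eta>inf\<close> in all transforms, and exceeding the other bound makes every quotient
    accurate enough to decode.\<close>
  have "S \<subseteq> K ` Q"
  proof
    fix k assume "k \<in> S"
    then have k: "k \<in> I" "norm (c k) > \<tau>" "norm (c k) > \<eta>inf * (1 + 2 / sin (pi / real N))"
      by (auto simp: S_def large_coeffs_def \<beta>_def c_def)
    let ?\<omega> = "centered_mod M (?\<sigma> k)"
    have "K ?\<omega> l = k l" for l
    proof (cases "l < d")
      case True
      have "norm (Poly_Mapping.lookup (vs l) ?\<omega> / Poly_Mapping.lookup v ?\<omega>
          - cis (2 * pi * of_int (k l) / real N)) < sin (pi / real N)"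
        using v[OF k(1,2)] vs[OF True k(1,2)] k \<eta>inf sin_pos
        by (intro ratio_error[of _ "c k" _ \<eta>inf]) auto
      moreover have "k l \<in> freq_band N"
        using k(1) I(2) True by (auto simp: PiE_iff)
      ultimately show ?thesis
        using True N by (simp add: K_def decoded_def phase_decoding)
    next
      \<comment> \<open>Both functions are extensional, hence \<open>undefined\<close> here.\<close>
      case False
      then show ?thesis
        using k(1) I(2) by (auto simp: K_def decoded_def PiE_iff extensional_def)
    qed
    then have "K ?\<omega> = k" by auto
    then show "k \<in> K ` Q"
      using v[OF k(1,2)] centered_mod_cong[of M "?\<sigma> k"]
      by (intro image_eqI[of _ _ ?\<omega>]) (auto simp: Q_def cong_sym)
  qed
  moreover have "K ` Q \<subseteq> freqs d"
    using K band by blast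
  moreover have "(\<lambda>k. (norm (c k))\<^sup>2) summable_on freqs d"
    using f by (intro summable_on_norm_square) (simp add: wiener_continuous_def c_def)
  moreover have "S \<subseteq> I" "\<And>k. k \<in> I - S \<Longrightarrow> norm (c k) \<le> \<beta>"
    by (auto simp: S_def large_coeffs_def c_def)
  moreover have \<beta>: "0 \<le> \<beta>"
    using \<eta>inf by (simp add: \<beta>_def)
  ultimately have error: "l2_seq_norm (freqs d) (\<lambda>k. Poly_Mapping.lookup b k - c k)
      \<le> E2 s M (sft_signal d I z f) (sft_noise d I z f \<nu>) + \<beta> * sqrt (real s - real (card S))
        + l2_seq_norm (freqs d) (\<lambda>k. restrict_seq I c k - restrict_seq S c k)
        + l2_seq_norm (freqs d) (\<lambda>k. c k - restrict_seq I c k)"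
    and "card S \<le> s"
    using decoding_error[of I "freqs d" K v ?\<sigma> M s "Poly_Mapping.lookup b" _ c S \<beta>, folded Q_def,
        OF I(1) \<open>I \<subseteq> freqs d\<close> _ inj keys_v b refl _ _ _ _ _ err]
    by blast+
  \<comment> \<open>By \<open>card S \<le> s\<close> the maximum equals the difference, and the
    factor may grow by the nonnegative \<open>\<eta>inf\<close>.\<close>
  have "\<beta> * sqrt (real s - real (card S)) \<le> (\<beta> + \<eta>inf) * sqrt (max (real s - real (card S)) 0)"
    using \<beta> \<eta>inf(1) \<open>card S \<le> s\<close> by (intro mult_mono) auto
  with error show "l2_seq_norm (freqs d) (\<lambda>k. Poly_Mapping.lookup b k - c k)
      \<le> E2 s M (sft_signal d I z f) (sft_noise d I z f \<nu>)
        + (\<beta> + \<eta>inf) * sqrt (max (real s - real (card S)) 0)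
        + l2_seq_norm (freqs d) (\<lambda>k. restrict_seq I c k - restrict_seq S c k)
        + l2_seq_norm (freqs d) (\<lambda>k. c k - restrict_seq I c k)"
    by linarith
  have "finite Q"
    by (simp add: Q_def)
  then have "card (Poly_Mapping.keys b) \<le> card Q"
    using keys_b by (rule surj_card_le)
  also have "\<dots> \<le> card (Poly_Mapping.keys v)"
    by (intro card_mono) (auto simp: Q_def)
  finally show "card (Poly_Mapping.keys b) \<le> s"
    using keys_v(2) by linarith
  show "card (Poly_Mapping.keys (run (\<A> s M) (\<lambda>t. f (lattice_line d z t) + \<nu> (lattice_line d z t)))) \<le> s"
    using keys_v(2) by (simp add: v_def)
qed

section \<open>Total cost with explicit constants\<close>

lemma phase_encoding_cost:
  fixes \<A> :: "nat \<Rightarrow> nat \<Rightarrow> sft" and f \<nu> :: "(nat \<Rightarrow> real) \<Rightarrow> complex"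
  assumes bound: "\<And>s M a \<mu>. s \<ge> 1 \<Longrightarrow> M \<ge> 1 \<Longrightarrow> wiener_continuous 1 (univariate a) \<Longrightarrow>
      torus_fun 1 (univariate \<mu>) \<Longrightarrow>
      real (evals (\<A> s M) (\<lambda>t. a t + \<mu> t)) \<le> C * P s M \<and>
      real (operations (\<A> s M) (\<lambda>t. a t + \<mu> t)) \<le> C * R s M"
    and nonneg: "0 \<le> P s M" "0 \<le> R s M"
    and input: "phase_encoding_input d N s M z I f \<nu>"
    and keys: "card (Poly_Mapping.keys (run (\<A> s M) (\<lambda>t. f (lattice_line d z t) + \<nu> (lattice_line d z t)))) \<le> s"
  shows "real (evals (phase_encoding N d z M (\<A> s M)) (\<lambda>x. f x + \<nu> x)) \<le> 2 * \<bar>C\<bar> * (real d * P s M)"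
    and "real (operations (phase_encoding N d z M (\<A> s M)) (\<lambda>x. f x + \<nu> x))
      \<le> (2 * \<bar>C\<bar> + 21) * (real d * (R s M + real s))"
proof -
  have d: "d \<ge> 1" and s: "s \<ge> 1" and M: "M \<ge> 1" and I: "finite I"
    using input by (auto simp: phase_encoding_input_def)
  have torus: "torus_fun 1 (univariate (sft_noise d I z f \<nu>))"
    unfolding sft_noise_def by (rule torus_fun_lattice_line)
  have torus_l: "torus_fun 1 (univariate (shifted_sft_noise d N I z f \<nu> l))" for l
    unfolding shifted_sft_noise_def by (rule torus_fun_lattice_line)
  have wiener: "wiener_continuous 1 (univariate (sft_signal d I z f))"
    unfolding sft_signal_eq by (rule wiener_continuous_trig_poly[OF I])
  have wiener_l: "wiener_continuous 1 (univariate (shifted_sft_signal d N I z f l))" if "l < d" for l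
    unfolding shifted_sft_signal_eq[OF that] by (rule wiener_continuous_trig_poly[OF I])
  have sample: "(\<lambda>t. sft_signal d I z f t + sft_noise d I z f \<nu> t) =
      (\<lambda>t. f (lattice_line d z t) + \<nu> (lattice_line d z t))"
    by (simp add: sft_signal_def sft_noise_def)
  have sample_l: "(\<lambda>t. shifted_sft_signal d N I z f l t + shifted_sft_noise d N I z f \<nu> l t) =
      (\<lambda>t. f (shift_point l (1 / real N) (lattice_line d z t)) + \<nu> (shift_point l (1 / real N) (lattice_line d z t)))" for l
    by (simp add: shifted_sft_signal_def shifted_sft_noise_def shift_op_def)
  note cost = bound[OF s M wiener torus, unfolded sample]
  have cost_l: "real (evals (\<A> s M) (\<lambda>t. f (shift_point l (1 / real N) (lattice_line d z t))
        + \<nu> (shift_point l (1 / real N) (lattice_line d z t)))) \<le> C * P s M \<and>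
      real (operations (\<A> s M) (\<lambda>t. f (shift_point l (1 / real N) (lattice_line d z t))
        + \<nu> (shift_point l (1 / real N) (lattice_line d z t)))) \<le> C * R s M" if "l < d" for l
    using bound[OF s M wiener_l[OF that] torus_l[of l]] unfolding sample_l .
  have abs: "C * P s M \<le> \<bar>C\<bar> * P s M" "C * R s M \<le> \<bar>C\<bar> * R s M"
    using nonneg by (auto intro!: mult_right_mono)
  \<comment> \<open>The cost lemmas for the program count in natural numbers, so the integer parts
    of the real bounds serve as their \<open>e\<close>.\<close>
  let ?p = "nat \<lfloor>\<bar>C\<bar> * P s M\<rfloor>" and ?r = "nat \<lfloor>\<bar>C\<bar> * R s M\<rfloor>"
  have p: "real ?p \<le> \<bar>C\<bar> * P s M" and r: "real ?r \<le> \<bar>C\<bar> * R s M"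
    using nonneg by (auto intro: of_nat_floor)
  have "evals (phase_encoding N d z M (\<A> s M)) (\<lambda>x. f x + \<nu> x) \<le> (d + 1) * ?p"
    using cost cost_l abs(1) by (intro evals_phase_encoding le_nat_floor) force+
  then have "real (evals (phase_encoding N d z M (\<A> s M)) (\<lambda>x. f x + \<nu> x)) \<le> real (d + 1) * real ?p"
    by (metis of_nat_le_iff of_nat_mult)
  also have "\<dots> \<le> (2 * real d) * (\<bar>C\<bar> * P s M)"
    using d p by (intro mult_mono) auto
  finally show "real (evals (phase_encoding N d z M (\<A> s M)) (\<lambda>x. f x + \<nu> x)) \<le> 2 * \<bar>C\<bar> * (real d * P s M)"
    by (simp add: mult_ac)
  have "operations (phase_encoding N d z M (\<A> s M)) (\<lambda>x. f x + \<nu> x)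
      \<le> (d + 1) * ?r + 2 * d + 1 + s * (14 * d + 4)"
    using cost cost_l abs(2) keys by (intro operations_phase_encoding le_nat_floor) force+
  \<comment> \<open>Each of \<open>d\<close>, \<open>s\<close> and 1 is at most
    \<open>d * s\<close>; the constant is 2 + 1 + 14 + 4.\<close>
  also have "\<dots> \<le> (2 * d) * ?r + 21 * (d * s)"
  proof -
    have "(d + 1) * ?r \<le> (2 * d) * ?r" "d \<le> d * s" "s \<le> d * s" "1 \<le> d * s"
      using d s by auto
    moreover have "s * (14 * d + 4) = 14 * (d * s) + 4 * s"
      by (simp add: algebra_simps)
    ultimately show ?thesis by linarith
  qed
  finally have "real (operations (phase_encoding N d z M (\<A> s M)) (\<lambda>x. f x + \<nu> x))
      \<le> real ((2 * d) * ?r + 21 * (d * s))"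
    by (simp only: of_nat_le_iff)
  also have "\<dots> = (2 * real d) * real ?r + 21 * (real d * real s)"
    by simp
  also have "\<dots> \<le> (2 * real d) * (\<bar>C\<bar> * R s M) + 21 * (real d * real s)"
    using r by (intro add_right_mono mult_left_mono) auto
  also have "\<dots> \<le> (2 * \<bar>C\<bar> + 21) * (real d * (R s M + real s))"
  proof -
    have "0 \<le> 21 * (real d * R s M)" "0 \<le> 2 * \<bar>C\<bar> * (real d * real s)"
      using nonneg by auto
    then show ?thesis by (simp add: algebra_simps)
  qed
  finally show "real (operations (phase_encoding N d z M (\<A> s M)) (\<lambda>x. f x + \<nu> x))
      \<le> (2 * \<bar>C\<bar> + 21) * (real d * (R s M + real s))" .
qed

theorem lemma5:
  fixes \<A> :: "nat \<Rightarrow> nat \<Rightarrow> sft"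
    and T Einf E2 :: tolerance
    and P R :: "nat \<Rightarrow> nat \<Rightarrow> real"
  assumes sft: "noise_robust_sft \<A> T Einf E2 P R"
  shows "\<exists>C\<^sub>1 C\<^sub>2 :: real. \<forall>d N s M z I f \<nu> \<tau> \<eta>inf \<eta>2.
    phase_encoding_input d N s M z I f \<nu> \<and>
    T s M (sft_signal d I z f) (sft_noise d I z f \<nu>) = \<tau> \<and>
    Einf s M (sft_signal d I z f) (sft_noise d I z f \<nu>) = \<eta>inf \<and>
    (\<forall>l<d. T s M (shifted_sft_signal d N I z f l) (shifted_sft_noise d N I z f \<nu> l) = \<tau> \<and>
           Einf s M (shifted_sft_signal d N I z f l) (shifted_sft_noise d N I z f \<nu> l) = \<eta>inf) \<and>
    E2 s M (sft_signal d I z f) (sft_noise d I z f \<nu>) = \<eta>2 \<and>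
    card ({k \<in> freqs d. fourier_coeff d f k \<noteq> 0} \<inter> large_coeffs d I f \<tau>) \<le> s \<longrightarrow>
    (let c = fourier_coeff d f;
         g = (\<lambda>x. f x + \<nu> x);
         alg = phase_encoding N d z M (\<A> s M);
         b = run alg g;
         \<beta> = max \<tau> (\<eta>inf * (1 + 2 / sin (pi / real N)));
         S\<beta> = large_coeffs d I f \<beta>
     in Poly_Mapping.keys b \<subseteq> ({..<d} \<rightarrow>\<^sub>E freq_band N) \<and>
        card (Poly_Mapping.keys b) \<le> s \<and>
        l2_seq_norm (freqs d) (\<lambda>k. Poly_Mapping.lookup b k - c k)
          \<le> \<eta>2 + (\<beta> + \<eta>inf) * sqrt (max (real s - real (card S\<beta>)) 0)
            + l2_seq_norm (freqs d) (\<lambda>k. restrict_seq I c k - restrict_seq S\<beta> c k)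
            + l2_seq_norm (freqs d) (\<lambda>k. c k - restrict_seq I c k) \<and>
        real (evals alg g) \<le> C\<^sub>1 * (real d * P s M) \<and>
        real (operations alg g) \<le> C\<^sub>2 * (real d * (R s M + real s)))"
proof -
  have "\<exists>C. \<forall>s\<ge>1. \<forall>M\<ge>1. \<forall>a \<mu>.
      wiener_continuous 1 (univariate a) \<and> torus_fun 1 (univariate \<mu>) \<longrightarrow>
      real (evals (\<A> s M) (\<lambda>t. a t + \<mu> t)) \<le> C * P s M \<and>
      real (operations (\<A> s M) (\<lambda>t. a t + \<mu> t)) \<le> C * R s M"
    using sft unfolding noise_robust_sft_def by (elim conjE)
  then obtain C where "\<forall>s\<ge>1. \<forall>M\<ge>1. \<forall>a \<mu>.
      wiener_continuous 1 (univariate a) \<and> torus_fun 1 (univariate \<mu>) \<longrightarrow>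
      real (evals (\<A> s M) (\<lambda>t. a t + \<mu> t)) \<le> C * P s M \<and>
      real (operations (\<A> s M) (\<lambda>t. a t + \<mu> t)) \<le> C * R s M" ..
  then have C: "real (evals (\<A> s M) (\<lambda>t. a t + \<mu> t)) \<le> C * P s M \<and>
      real (operations (\<A> s M) (\<lambda>t. a t + \<mu> t)) \<le> C * R s M"
    if "s \<ge> 1" "M \<ge> 1" "wiener_continuous 1 (univariate a)" "torus_fun 1 (univariate \<mu>)" for s M a \<mu>
    using that by simp
  have "\<forall>s M. 0 \<le> P s M \<and> 0 \<le> R s M"
    using sft unfolding noise_robust_sft_def by (elim conjE)
  then have nonneg: "0 \<le> P s M" "0 \<le> R s M" for s M
    by simp_all
  show ?thesis
    unfolding Let_def
  \<comment> \<open>Both witnesses depend only on the constant of the sparse transform, hence are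
    uniform in the dimension and the input.\<close>
  proof (rule exI[of _ "2 * \<bar>C\<bar>"], rule exI[of _ "2 * \<bar>C\<bar> + 21"], intro allI impI, elim conjE)
    fix d N s M z I f \<nu> \<tau> \<eta>inf \<eta>2
    assume input: "phase_encoding_input d N s M z I f \<nu>"
      and par: "T s M (sft_signal d I z f) (sft_noise d I z f \<nu>) = \<tau>"
        "Einf s M (sft_signal d I z f) (sft_noise d I z f \<nu>) = \<eta>inf"
      and shifted: "\<forall>l<d. T s M (shifted_sft_signal d N I z f l) (shifted_sft_noise d N I z f \<nu> l) = \<tau> \<and>
        Einf s M (shifted_sft_signal d N I z f l) (shifted_sft_noise d N I z f \<nu> l) = \<eta>inf"
      and E2: "E2 s M (sft_signal d I z f) (sft_noise d I z f \<nu>) = \<eta>2"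
      and sparse: "card ({k \<in> freqs d. fourier_coeff d f k \<noteq> 0} \<inter> large_coeffs d I f \<tau>) \<le> s"
    note accuracy = phase_encoding_accuracy[OF sft input par shifted sparse, unfolded E2]
    note cost = phase_encoding_cost[where \<A> = \<A> and C = C and P = P and R = R, OF C nonneg input accuracy(3)]
    show "Poly_Mapping.keys (run (phase_encoding N d z M (\<A> s M)) (\<lambda>x. f x + \<nu> x))
          \<subseteq> ({..<d} \<rightarrow>\<^sub>E freq_band N) \<and>
        card (Poly_Mapping.keys (run (phase_encoding N d z M (\<A> s M)) (\<lambda>x. f x + \<nu> x))) \<le> s \<and>
        l2_seq_norm (freqs d) (\<lambda>k. Poly_Mapping.lookup
            (run (phase_encoding N d z M (\<A> s M)) (\<lambda>x. f x + \<nu> x)) k - fourier_coeff d f k)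
          \<le> \<eta>2 + (max \<tau> (\<eta>inf * (1 + 2 / sin (pi / real N))) + \<eta>inf)
              * sqrt (max (real s - real (card (large_coeffs d I f
                  (max \<tau> (\<eta>inf * (1 + 2 / sin (pi / real N))))))) 0)
            + l2_seq_norm (freqs d) (\<lambda>k. restrict_seq I (fourier_coeff d f) k
                - restrict_seq (large_coeffs d I f (max \<tau> (\<eta>inf * (1 + 2 / sin (pi / real N)))))
                    (fourier_coeff d f) k)
            + l2_seq_norm (freqs d) (\<lambda>k. fourier_coeff d f k - restrict_seq I (fourier_coeff d f) k) \<and>
        real (evals (phase_encoding N d z M (\<A> s M)) (\<lambda>x. f x + \<nu> x)) \<le> 2 * \<bar>C\<bar> * (real d * P s M) \<and>
        real (operations (phase_encoding N d z M (\<A> s M)) (\<lambda>x. f x + \<nu> x))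
          \<le> (2 * \<bar>C\<bar> + 21) * (real d * (R s M + real s))"
      by (intro conjI accuracy(1,2,4) cost)
  qed
qed

end
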